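(* Let $n,k,r,\ell$ be positive integers with $0<r<k$, and let $b,b_1,\dots,b_n$ and $s_1,\dots,s_{\ell+1}$ be nonnegative integers with $\sum_{i=1}^n b_i=b$, $\sum_{i=1}^n i\,b_i\le n$, $\sum_{i=1}^{\ell+1}s_i=n$ and $s_1=n-b$. Then the number of multichains $\pi_1\le\cdots\le\pi_\ell$ in $\mathrm{NC}^{(k)}(n;r)$ with rank jump vector $(s_1,\dots,s_{\ell+1})$ and $\mathrm{type}^{(k)}(\pi_1)=(b;b_1,\dots,b_n)$ equals $$\binom{b}{b_1,\dots,b_n}\binom{kn+r}{s_2}\cdots\binom{kn+r}{s_{\ell+1}}.$$
   Context: A partition of $[N]$ is noncrossing if there are no $a<b<c<d$ with $a,c$ in one block and $b,d$ in a different block. For $0<r<k$, $\mathrm{NC}^{(k)}(n;r)$ is the poset, ordered by refinement, of noncrossing partitions of $[kn+r]$ in which the sizes of all but one of the blocks are divisible by $k$. It is graded with $\mathrm{rank}(\pi)=n-\mathrm{bk}'(\pi)$, where $\mathrm{bk}'(\pi)$ is the number of blocks of size divisible by $k$; the maximum has rank $n$. $\mathrm{type}^{(k)}(\pi)=(b;b_1,\dots,b_n)$ where $b_i$ is the number of blocks of size $ki$ and $b=\sum b_i$. For a multichain $\pi_1\le\cdots\le\pi_\ell$ (repetitions allowed), the rank jump vector is $(s_1,\dots,s_{\ell+1})$ with $s_1=\mathrm{rank}(\pi_1)$, $s_i=\mathrm{rank}(\pi_i)-\mathrm{rank}(\pi_{i-1})$ for $2\le i\le\ell$, $s_{\ell+1}=n-\mathrm{rank}(\pi_\ell)$.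 *)

theory Defs
  imports Main "HOL-Library.Disjoint_Sets"
begin

definition noncrossing :: "nat set set \<Rightarrow> bool" where
  "noncrossing P \<longleftrightarrow>
     \<not> (\<exists>a b c d B1 B2. a < b \<and> b < c \<and> c < d \<and> B1 \<in> P \<and> B2 \<in> P \<and> B1 \<noteq> B2 \<and>
            a \<in> B1 \<and> c \<in> B1 \<and> b \<in> B2 \<and> d \<in> B2)"

definition NCk :: "nat \<Rightarrow> nat \<Rightarrow> nat \<Rightarrow> nat set set \<Rightarrow> bool" where
  "NCk k n r P \<longleftrightarrow> partition_on {1..k*n+r} P \<and> noncrossing P \<and>
     (\<exists>B0\<in>P. \<forall>B\<in>P. B \<noteq> B0 \<longrightarrow> k dvd card B)"

definition refines :: "nat set set \<Rightarrow> nat set set \<Rightarrow> bool" where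
  "refines P Q \<longleftrightarrow> (\<forall>B\<in>P. \<exists>C\<in>Q. B \<subseteq> C)"

definition bkprime :: "nat \<Rightarrow> nat set set \<Rightarrow> nat" where
  "bkprime k P = card {B\<in>P. k dvd card B}"

definition nc_rank :: "nat \<Rightarrow> nat \<Rightarrow> nat set set \<Rightarrow> int" where
  "nc_rank k n P = int n - int (bkprime k P)"

definition has_type :: "nat \<Rightarrow> nat \<Rightarrow> nat set set \<Rightarrow> nat \<Rightarrow> (nat \<Rightarrow> nat) \<Rightarrow> bool" where
  "has_type k n P b bs \<longleftrightarrow>
     (\<forall>i\<in>{1..n}. card {B\<in>P. card B = k*i} = bs i) \<and>
     b = (\<Sum>i=1..n. card {B\<in>P. card B = k*i})"

text \<open>Multichain pi_1 <= ... <= pi_l in NC^(k)(n;r), given as list [pi_1,...,pi_l]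
  (pi_i = cs ! (i-1)).\<close>
definition nc_multichain :: "nat \<Rightarrow> nat \<Rightarrow> nat \<Rightarrow> nat \<Rightarrow> nat set set list \<Rightarrow> bool" where
  "nc_multichain k n r l cs \<longleftrightarrow> length cs = l \<and> (\<forall>P\<in>set cs. NCk k n r P) \<and>
     (\<forall>i. i + 1 < l \<longrightarrow> refines (cs ! i) (cs ! (i+1)))"

text \<open>Rank jump vector, 1-based index j in {1..l+1}.\<close>
definition rank_jump :: "nat \<Rightarrow> nat \<Rightarrow> nat set set list \<Rightarrow> nat \<Rightarrow> int" where
  "rank_jump k n cs j =
     (let l = length cs in
      if j = 1 then nc_rank k n (cs ! 0)
      else if j = l + 1 then int n - nc_rank k n (cs ! (l - 1))
      else nc_rank k n (cs ! (j - 1)) - nc_rank k n (cs ! (j - 2)))"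

definition multinomial :: "nat \<Rightarrow> (nat \<Rightarrow> nat) \<Rightarrow> nat \<Rightarrow> nat" where
  "multinomial b bs n = fact b div (\<Prod>i=1..n. fact (bs i))"

end

theory Submission
  imports Defs "HOL-Combinatorics.Multiset_Permutations"
begin

text \<open>Put N = kn+r. A coarsening of a member of NC^(k)(n;r) that is noncrossing is again a member,
  so only the first partition of a chain feels k: its blocks other than one marked block Z have sizes
  forming a prescribed multiset beta, and rank jumps become differences of block numbers.

  By rotating [N] the number of chains with a given y in Z does not depend on y, so it suffices to count
  the chains with 1 in Z; there the answer carries the ballot factor 1 - (sum of beta)/N.
  These chains are counted by a recursion. If N lies in the block of 1 at every level, delete N.
  Otherwise let J be the last level at which N and 1 are separated and x the least element of the block
  of N at level J. At all levels up to J no block straddles x, and merging there the block of x into the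
  block of 1 loses no information except the size m of the block of x in the first partition: conversely
  x is the m-th largest element of the merged first block. This is the noncrossing-partition form of
  reading off the outermost closing bracket at position N in Edelman's encoding.\<close>

text \<open>The ballot factor comes from double counting: Z has N - (sum of beta) points, so
  averaging over rotations puts 1 in Z for this fraction of N. Reading it backwards requires Z to be
  recognisable by its size, which holds because k divides every size in beta but not N; here 0 < r <
  k enters.

  The obstacle is that one merge does not finish with N: afterwards N is with 1 from level J on, but
  may still be separated from 1 at lower levels. Hence the family \<open>linked_chains\<close>,
  which interpolates in J between all chains on N points (J = l) and, after deleting N, all chains
  on N - 1 points (J = 0). Its count must be known for every J, and for intermediate J the
  correction is no longer (sum of beta)/N. The closed form splits that correction as (mean entry of
  beta) * (size of beta)/N and replaces the second factor by the sum of s_i over the number of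
  positions open to colour i. The recursion respects this form for two reasons: the product of
  binomials and its multiple by that sum both obey a Pascal rule, and deleting a random entry of
  beta preserves the mean entry on average.\<close>

section \<open>Noncrossing partitions, their blocks and refinement\<close>

definition nc :: "nat \<Rightarrow> nat set set \<Rightarrow> bool" where
  "nc N P \<longleftrightarrow> partition_on {1..N} P \<and> noncrossing P"

definition block :: "nat set set \<Rightarrow> nat \<Rightarrow> nat set" where
  "block P x = (THE B. B \<in> P \<and> x \<in> B)"

lemma noncrossingD:
  assumes "noncrossing P" "B \<in> P" "D \<in> P" "a \<in> B" "c \<in> B" "b \<in> D" "d \<in> D" "a < b" "b < c" "c < d"
  shows "B = D"
  using assms unfolding noncrossing_def by blast

lemma nc_disj: "nc N P \<Longrightarrow> B \<in> P \<Longrightarrow> C \<in> P \<Longrightarrow> x \<in> B \<Longrightarrow> x \<in> C \<Longrightarrow> B = C"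
  unfolding nc_def partition_on_def disjoint_def by blast

lemma nc_finite: "nc N P \<Longrightarrow> finite P"
  unfolding nc_def using finite_elements by blast

lemma nc_subset: "nc N P \<Longrightarrow> B \<in> P \<Longrightarrow> B \<subseteq> {1..N}"
  unfolding nc_def partition_on_def by blast

lemma nc_finite_block: "nc N P \<Longrightarrow> B \<in> P \<Longrightarrow> finite B"
  by (meson finite_atLeastAtMost finite_subset nc_subset)

lemma nc_nonempty: "nc N P \<Longrightarrow> B \<in> P \<Longrightarrow> B \<noteq> {}"
  unfolding nc_def partition_on_def by blast

lemma block_eq: "nc N P \<Longrightarrow> B \<in> P \<Longrightarrow> x \<in> B \<Longrightarrow> block P x = B"
  unfolding block_def by (rule the_equality) (auto dest: nc_disj)

lemma block_mem:
  assumes "nc N P" "x \<in> {1..N}" shows "block P x \<in> P" "x \<in> block P x"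
proof -
  obtain B where "B \<in> P" "x \<in> B"
    using assms unfolding nc_def partition_on_def by blast
  then show "block P x \<in> P" "x \<in> block P x" using block_eq[OF assms(1)] by auto
qed

lemma block_mem_iff: "nc N P \<Longrightarrow> x \<in> {1..N} \<Longrightarrow> y \<in> block P x \<Longrightarrow> block P y = block P x"
  using block_eq block_mem by blast

lemma nc_crossD:
  assumes "nc N P" "B \<in> P" "D \<in> P" "a \<in> B" "c \<in> B" "b \<in> D" "d \<in> D" "a < b" "b < c" "c < d"
  shows "B = D"
  using assms noncrossingD unfolding nc_def by blast

lemma refines_refl: "refines P P" unfolding refines_def by blast

lemma refines_trans: "refines P Q \<Longrightarrow> refines Q R \<Longrightarrow> refines P R"
  unfolding refines_def by (meson subset_trans)

lemma refines_block:
  assumes "nc N P" "nc N Q" "refines P Q" "x \<in> {1..N}"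
  shows "block P x \<subseteq> block Q x"
proof -
  obtain C where "C \<in> Q" "block P x \<subseteq> C"
    using assms block_mem unfolding refines_def by meson
  then show ?thesis using block_mem[OF assms(1,4)] block_eq[OF assms(2)] by blast
qed

text \<open>Sending a block of P to a block of Q around it is onto, because blocks of Q are nonempty
  and disjoint. It later shows that a level with something to merge has a positive drop.\<close>

lemma refines_card:
  assumes "nc N P" "nc N Q" "refines P Q"
  shows "card Q \<le> card P"
proof -
  obtain f where f: "\<And>B. B \<in> P \<Longrightarrow> f B \<in> Q \<and> B \<subseteq> f B"
    using assms(3) unfolding refines_def by metis
  have "Q \<subseteq> f ` P"
  proof
    fix C assume C: "C \<in> Q"
    then obtain x where x: "x \<in> C" "x \<in> {1..N}" using nc_nonempty[OF assms(2)] nc_subset[OF assms(2)] by blast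
    have "f (block P x) = C"
      using f block_mem[OF assms(1) x(2)] nc_disj[OF assms(2)] C x(1) by blast
    then show "C \<in> f ` P" using block_mem[OF assms(1) x(2)] by blast
  qed
  then show ?thesis using nc_finite[OF assms(1)] by (meson card_image_le card_mono finite_imageI le_trans)
qed

section \<open>Splitting and merging the block of 1\<close>

text \<open>The point x counts to the upper side, so that it can be the least element of a split-off
  piece.\<close>

definition cut :: "nat \<Rightarrow> nat set set \<Rightarrow> bool" where
  "cut x P \<longleftrightarrow> (\<forall>D\<in>P. D \<subseteq> {..<x} \<or> D \<subseteq> {x..})"

definition split_first :: "nat \<Rightarrow> nat set set \<Rightarrow> nat set set" where
  "split_first x P = insert (block P 1 \<inter> {..<x}) (insert (block P 1 \<inter> {x..}) (P - {block P 1}))"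

definition join_first :: "nat \<Rightarrow> nat set set \<Rightarrow> nat set set" where
  "join_first x P = insert (block P 1 \<union> block P x) (P - {block P 1, block P x})"

lemma cut_mono: "refines P Q \<Longrightarrow> cut x Q \<Longrightarrow> cut x P"
  unfolding refines_def cut_def by (meson subset_trans)

text \<open>This keeps a chain a chain when its lower levels are split: a block of P inside the
  block of 1 of Q lies on one side of x, hence in one of the two pieces.\<close>

lemma refines_split_first:
  assumes "refines P Q" "cut x P"
  shows "refines P (split_first x Q)"
  unfolding refines_def
proof
  fix D assume D: "D \<in> P"
  then obtain E where E: "E \<in> Q" "D \<subseteq> E" using assms unfolding refines_def by blast
  show "\<exists>C\<in>split_first x Q. D \<subseteq> C"
  proof (cases "E = block Q 1")
    case True
    have "D \<subseteq> {..<x} \<or> D \<subseteq> {x..}" using assms(2) D unfolding cut_def by blast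
    then have "D \<subseteq> block Q 1 \<inter> {..<x} \<or> D \<subseteq> block Q 1 \<inter> {x..}" using True E(2) by auto
    then show ?thesis unfolding split_first_def by (meson insertCI)
  next
    case False
    then have "E \<in> split_first x Q" using E unfolding split_first_def by simp
    then show ?thesis using E by blast
  qed
qed

lemma split_first_refines: "nc N P \<Longrightarrow> 1 \<le> N \<Longrightarrow> refines (split_first x P) P"
  unfolding refines_def split_first_def using block_mem[of N P 1] by auto

lemma refines_join_first: "refines P (join_first x P)"
proof -
  have "D \<subseteq> block P 1 \<union> block P x \<or> D \<in> P - {block P 1, block P x}" if "D \<in> P" for D
    using that by auto
  then show ?thesis unfolding refines_def join_first_def by (meson insertCI subset_refl)
qed

text \<open>Among the coarsenings of P that put x with 1, \<open>join_first x P\<close> is the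
  finest.\<close>

lemma join_first_refines:
  assumes "nc N P" "nc N Q" "1 \<le> N" "x \<in> {1..N}" "refines P Q" "x \<in> block Q 1"
  shows "refines (join_first x P) Q"
proof -
  have Q1: "block Q 1 \<in> Q" using block_mem[OF assms(2)] assms by auto
  have "block P 1 \<subseteq> block Q 1" using refines_block[OF assms(1,2,5)] assms by auto
  moreover have "block P x \<subseteq> block Q 1"
    using refines_block[OF assms(1,2,5,4)] block_mem_iff[OF assms(2) _ assms(6)] assms(3) by auto
  ultimately show ?thesis using assms(5) Q1 unfolding refines_def join_first_def by auto
qed

context
  fixes N x :: nat
  assumes x: "1 < x" "x \<le> N"
begin

text \<open>Another block with elements a < x \<le> c would satisfy 1 < a < x < c and cross the
  block that contains 1 and x.\<close>

lemma cut_split_first: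
  assumes "nc N Q" "x \<in> block Q 1"
  shows "cut x (split_first x Q)"
proof -
  have Q1: "block Q 1 \<in> Q" "1 \<in> block Q 1" using block_mem[OF assms(1)] x by auto
  have "D \<subseteq> {..<x} \<or> D \<subseteq> {x..}" if D: "D \<in> Q" "D \<noteq> block Q 1" for D
  proof (rule ccontr)
    assume "\<not> ?thesis"
    then obtain a c where ac: "a \<in> D" "c \<in> D" "a < x" "c \<ge> x" by fastforce
    have "a \<noteq> 1" "c \<noteq> x" using ac D Q1 nc_disj[OF assms(1) D(1) Q1(1)] assms(2) by blast+
    moreover have "a \<ge> 1" using ac nc_subset[OF assms(1) D(1)] by auto
    ultimately
    show False
      using nc_crossD[OF assms(1) Q1(1) D(1) Q1(2) assms(2) ac(1,2)] ac D by auto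
  qed
  then show ?thesis unfolding cut_def split_first_def by auto
qed

text \<open>Crossing blocks of the finer partition must lie in one block of Q, hence are the two
  pieces of the block of 1; x separates these, so they cannot interleave.\<close>

lemma nc_split_first:
  assumes "nc N Q" "x \<in> block Q 1"
  shows "nc N (split_first x Q)"
    and "block (split_first x Q) 1 = block Q 1 \<inter> {..<x}"
    and "block (split_first x Q) x = block Q 1 \<inter> {x..}"
    and "card (split_first x Q) = Suc (card Q)"
    and "{B \<in> split_first x Q. 1 \<notin> B} = insert (block Q 1 \<inter> {x..}) {B \<in> Q. 1 \<notin> B}"
    and "block Q 1 \<inter> {x..} \<notin> Q"
proof -
  define Z where "Z = block Q 1"
  have Z: "Z \<in> Q" "1 \<in> Z" "x \<in> Z" using block_mem[OF assms(1)] x assms unfolding Z_def by auto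
  have disj: "\<And>D. D \<in> Q \<Longrightarrow> D \<noteq> Z \<Longrightarrow> D \<inter> Z = {}" using nc_disj[OF assms(1)] Z by blast
  have S: "split_first x Q = insert (Z \<inter> {..<x}) (insert (Z \<inter> {x..}) (Q - {Z}))"
    unfolding split_first_def Z_def ..
  have "1 \<notin> Z \<inter> {x..}" "x \<in> Z \<inter> {x..}" "x \<notin> Z \<inter> {..<x}" "1 \<in> Z \<inter> {..<x}"
    using Z x by auto
  then have n1: "Z \<inter> {x..} \<notin> Q" and n2: "Z \<inter> {..<x} \<notin> Q"
    using nc_disj[OF assms(1)] Z by blast+
  have part: "partition_on {1..N} (split_first x Q)"
    unfolding partition_on_def
  proof (intro conjI)
    have "\<Union>Q = {1..N}" using assms(1) unfolding nc_def partition_on_def by blast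
    moreover have "\<Union>(split_first x Q) = \<Union>Q" unfolding S using Z by (auto simp: not_less)
    ultimately show "\<Union>(split_first x Q) = {1..N}" by simp
    show "disjoint (split_first x Q)"
    proof (rule disjointI, rule ccontr)
      fix B D assume h: "B \<in> split_first x Q" "D \<in> split_first x Q" "B \<noteq> D" "B \<inter> D \<noteq> {}"
      then obtain y where y: "y \<in> B" "y \<in> D" by blast
      show False
      proof (cases "y \<in> Z")
        case True
        then have "B \<in> {Z \<inter> {..<x}, Z \<inter> {x..}}" "D \<in> {Z \<inter> {..<x}, Z \<inter> {x..}}"
          using h(1,2) y disj unfolding S by blast+
        then show ?thesis using h(3) y by auto
      next
        case False
        then have "B \<in> Q" "D \<in> Q" using h(1,2) y unfolding S by blast+
        then show ?thesis using nc_disj[OF assms(1)] y h(3) by blast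
      qed
    qed
    have "{} \<notin> Q" using nc_nonempty[OF assms(1)] by blast
    then show "{} \<notin> split_first x Q" unfolding S using Z x by auto
  qed
  have "noncrossing (split_first x Q)"
    unfolding noncrossing_def
  proof (rule notI, elim exE conjE)
    fix a b c d B D
    assume h: "a < b" "b < c" "c < d" "B \<in> split_first x Q" "D \<in> split_first x Q"
      "a \<in> B" "c \<in> B" "b \<in> D" "d \<in> D" "B \<noteq> D"
    obtain B' where B': "B' \<in> Q" "B \<subseteq> B'"
      using split_first_refines[OF assms(1)] h x unfolding refines_def by (meson le_trans less_imp_le)
    obtain D' where D': "D' \<in> Q" "D \<subseteq> D'"
      using split_first_refines[OF assms(1)] h x unfolding refines_def by (meson le_trans less_imp_le)
    have eq: "B' = D'" using nc_crossD[OF assms(1) B'(1) D'(1), of a c b d] h B' D' by blast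
    have "B' = Z"
    proof (rule ccontr)
      assume nz: "B' \<noteq> Z"
      then have "B' \<inter> Z = {}" using disj B' by blast
      then have "B \<in> Q" "D \<in> Q" using h B' D' eq unfolding S by blast+
      then have "B = B'" "D = B'" using nc_disj[OF assms(1)] B' D' eq h by blast+
      then show False using h by simp
    qed
    then have "B \<in> {Z \<inter> {..<x}, Z \<inter> {x..}}" "D \<in> {Z \<inter> {..<x}, Z \<inter> {x..}}"
      using h B' D' eq disj unfolding S by blast+
    then show False using h by auto
  qed
  with part show nc: "nc N (split_first x Q)" unfolding nc_def by simp
  show "block (split_first x Q) 1 = block Q 1 \<inter> {..<x}"
    by (rule block_eq[OF nc]) (use S Z x Z_def in auto)
  show "block (split_first x Q) x = block Q 1 \<inter> {x..}"
    by (rule block_eq[OF nc]) (use S Z x Z_def in auto)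
  have ne: "Z \<inter> {..<x} \<noteq> Z \<inter> {x..}" using Z by auto
  have "card (split_first x Q) = Suc (Suc (card (Q - {Z})))"
    unfolding S using n1 n2 ne nc_finite[OF assms(1)] by simp
  moreover have "card Q = Suc (card (Q - {Z}))"
    using Z nc_finite[OF assms(1)] by (metis card_Suc_Diff1)
  ultimately show "card (split_first x Q) = Suc (card Q)" by simp
  show "{B \<in> split_first x Q. 1 \<notin> B} = insert (block Q 1 \<inter> {x..}) {B \<in> Q. 1 \<notin> B}"
    unfolding S Z_def[symmetric] using Z x by auto
  show "block Q 1 \<inter> {x..} \<notin> Q" using n1 Z_def by simp
qed

lemma join_split_first:
  assumes "nc N Q" "x \<in> block Q 1"
  shows "join_first x (split_first x Q) = Q"
proof -
  define Z where "Z = block Q 1"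
  have Z: "Z \<in> Q" "1 \<in> Z" "x \<in> Z" using block_mem[OF assms(1)] x assms unfolding Z_def by auto
  have "1 \<notin> Z \<inter> {x..}" "x \<in> Z \<inter> {x..}" "x \<notin> Z \<inter> {..<x}" "1 \<in> Z \<inter> {..<x}"
    using Z x by auto
  then have n1: "Z \<inter> {x..} \<notin> Q" and n2: "Z \<inter> {..<x} \<notin> Q"
    using nc_disj[OF assms(1)] Z by blast+
  have "Z \<inter> {..<x} \<union> Z \<inter> {x..} = Z" by auto
  then show ?thesis
    unfolding join_first_def nc_split_first(2,3)[OF assms] unfolding split_first_def Z_def[symmetric]
    using n1 n2 Z by auto
qed

text \<open>Merging two blocks may create crossings in general. Here the part Z below x is protected
  by containing the minimum 1, and the part Y from x on by the cut, which keeps every block on one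
  side of x.\<close>

lemma nc_join_first:
  assumes "nc N P" "cut x P"
  shows "nc N (join_first x P)"
    and "block (join_first x P) 1 = block P 1 \<union> block P x"
    and "card P = Suc (card (join_first x P))"
    and "split_first x (join_first x P) = P"
    and "block P x = block (join_first x P) 1 \<inter> {x..}"
proof -
  define Z Y where "Z = block P 1" and "Y = block P x"
  have Z: "Z \<in> P" "1 \<in> Z" and Y: "Y \<in> P" "x \<in> Y"
    using block_mem[OF assms(1)] x unfolding Z_def Y_def by auto
  have Zx: "Z \<subseteq> {..<x}" using Z assms(2) x unfolding cut_def by force
  have Yx: "Y \<subseteq> {x..}" using Y assms(2) x unfolding cut_def by force
  have ne: "Z \<noteq> Y" using Zx Y by auto
  have J: "join_first x P = insert (Z \<union> Y) (P - {Z, Y})" unfolding join_first_def Z_def Y_def ..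
  have disj: "\<And>D. D \<in> P \<Longrightarrow> D \<noteq> Z \<Longrightarrow> D \<inter> Z = {}" using nc_disj[OF assms(1)] Z by blast
  have disj': "\<And>D. D \<in> P \<Longrightarrow> D \<noteq> Y \<Longrightarrow> D \<inter> Y = {}" using nc_disj[OF assms(1)] Y by blast
  have part: "partition_on {1..N} (join_first x P)"
    unfolding partition_on_def
  proof (intro conjI)
    have "\<Union>P = {1..N}" using assms(1) unfolding nc_def partition_on_def by blast
    moreover have "\<Union>(join_first x P) = \<Union>P" unfolding J using Z Y by auto
    ultimately show "\<Union>(join_first x P) = {1..N}" by simp
    show "disjoint (join_first x P)"
    proof (rule disjointI, rule ccontr)
      fix B D assume h: "B \<in> join_first x P" "D \<in> join_first x P" "B \<noteq> D" "B \<inter> D \<noteq> {}"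
      then obtain y where y: "y \<in> B" "y \<in> D" by blast
      show False
      proof (cases "y \<in> Z \<union> Y")
        case True
        then have "B = Z \<union> Y" "D = Z \<union> Y"
          using h(1,2) y disj disj' unfolding J by blast+
        then show ?thesis using h(3) by simp
      next
        case False
        then have "B \<in> P" "D \<in> P" using h(1,2) y unfolding J by blast+
        then show ?thesis using nc_disj[OF assms(1)] y h(3) by blast
      qed
    qed
    have "{} \<notin> P" using nc_nonempty[OF assms(1)] by blast
    then show "{} \<notin> join_first x P" unfolding J using Z by auto
  qed
  \<comment> \<open>As 1 is in Z and precedes a, the blocks Z and D would cross at 1 < a < b <
    c.\<close>
  have ZD: False if "D \<in> P" "D \<noteq> Z" "a \<in> D" "c \<in> D" "b \<in> Z" "a < b" "b < c" for D a b c
    using nc_crossD[OF assms(1) Z(1) that(1) Z(2) that(5,3,4)] that nc_subset[OF assms(1) that(1)] Z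
      nc_disj[OF assms(1) that(1) Z(1), of 1] by (cases "a = 1") auto
  have no1: False if h: "D \<in> P" "D \<noteq> Z" "D \<noteq> Y" "a < b" "b < c" "c < d" "a \<in> D" "c \<in> D" "b \<in> Z \<union> Y" "d \<in> Z \<union> Y" for D a b c d
  proof (cases "b \<in> Z")
    case True then show ?thesis using ZD h by blast
  next
    case False
    then have "b \<in> Y" using h by auto
    then have "d \<in> Y" using h Zx Yx by (metis Un_iff atLeast_iff lessThan_iff less_trans not_less subsetD)
    then show ?thesis using nc_crossD[OF assms(1) h(1) Y(1) h(7,8) \<open>b \<in> Y\<close>] h by auto
  qed
  have no2: False if h: "D \<in> P" "D \<noteq> Z" "D \<noteq> Y" "a < b" "b < c" "c < d" "a \<in> Z \<union> Y" "c \<in> Z \<union> Y" "b \<in> D" "d \<in> D" for D a b c d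
  proof (cases "c \<in> Z")
    case True then show ?thesis using ZD[of D b d c] h by blast
  next
    case False
    then have c: "c \<in> Y" using h by auto
    \<comment> \<open>The element a may lie in Z and then says nothing about Y. The cut lets x
      replace it: D reaches beyond x, so it lies to the right of x, and x < b < c < d is a crossing
      of Y and D.\<close>
    then have "d > x" using Yx h by fastforce
    then have "D \<subseteq> {x..}" using h assms(2) unfolding cut_def by force
    then have "x < b" using h Y disj'[OF h(1,3)] by (metis disjoint_iff le_neq_implies_less atLeast_iff subsetD)
    then show ?thesis using nc_crossD[OF assms(1) Y(1) h(1) Y(2) c h(9,10)] h by auto
  qed
  have "noncrossing (join_first x P)"
    unfolding noncrossing_def
  proof (rule notI, elim exE conjE)
    fix a b c d B D
    assume h: "a < b" "b < c" "c < d" "B \<in> join_first x P" "D \<in> join_first x P"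
      "a \<in> B" "c \<in> B" "b \<in> D" "d \<in> D" "B \<noteq> D"
    consider "B = Z \<union> Y" "D \<in> P" "D \<noteq> Z" "D \<noteq> Y" | "D = Z \<union> Y" "B \<in> P" "B \<noteq> Z" "B \<noteq> Y" | "B \<in> P" "D \<in> P"
      using h unfolding J by auto
    then show False
    proof cases
      case 1 then show ?thesis using no2 h by blast
    next
      case 2 then show ?thesis using no1 h by blast
    next
      case 3 then show ?thesis using nc_crossD[OF assms(1) 3 h(6-9)] h by auto
    qed
  qed
  with part show nc: "nc N (join_first x P)" unfolding nc_def by simp
  show b: "block (join_first x P) 1 = block P 1 \<union> block P x"
    by (rule block_eq[OF nc]) (use J Z Z_def Y_def in auto)
  have nin: "Z \<union> Y \<notin> P" using disj[of "Z \<union> Y"] ne disj'[of "Z \<union> Y"] Z Y by blast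
  have "card (join_first x P) = Suc (card (P - {Z, Y}))"
    unfolding J using nin nc_finite[OF assms(1)] by simp
  moreover have "card P = Suc (Suc (card (P - {Z,Y})))"
  proof -
    have "P = insert Z (insert Y (P - {Z, Y}))" using Z Y by blast
    then have "card P = card (insert Z (insert Y (P - {Z, Y})))" by simp
    then show ?thesis using ne nc_finite[OF assms(1)] by simp
  qed
  ultimately show "card P = Suc (card (join_first x P))" by simp
  have i: "(Z \<union> Y) \<inter> {..<x} = Z" "(Z \<union> Y) \<inter> {x..} = Y" using Zx Yx by fastforce+
  show "split_first x (join_first x P) = P"
    unfolding split_first_def b Z_def[symmetric] Y_def[symmetric] i unfolding J using Z Y nin by auto
  show "block P x = block (join_first x P) 1 \<inter> {x..}"
    unfolding b Z_def[symmetric] Y_def[symmetric] i ..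
qed

end

text \<open>Mirror image of \<open>cut_split_first\<close> with N in the role of 1: a straddling
  block would satisfy a < x < c < N and cross the block of N at x and N.\<close>

lemma cut_Min_block:
  assumes "nc N P" "1 \<le> N"
  shows "cut (Min (block P N)) P"
proof -
  define Y x where "Y = block P N" and "x = Min Y"
  have Y: "Y \<in> P" "N \<in> Y" using block_mem[OF assms(1)] assms unfolding Y_def by auto
  have fin: "finite Y" using nc_finite_block[OF assms(1) Y(1)] .
  have x: "x \<in> Y" "\<And>y. y \<in> Y \<Longrightarrow> x \<le> y" using fin Y unfolding x_def by (auto intro: Min_in)
  have "D \<subseteq> {..<x} \<or> D \<subseteq> {x..}" if D: "D \<in> P" for D
  proof (rule ccontr)
    assume "\<not> ?thesis"
    then obtain a c where ac: "a \<in> D" "c \<in> D" "a < x" "c \<ge> x" by fastforce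
    have ne: "D \<noteq> Y" using ac x by force
    have "c \<noteq> x" "c \<noteq> N" using ne ac nc_disj[OF assms(1) D Y(1)] x Y by auto
    moreover have "c \<le> N" using ac nc_subset[OF assms(1) D] by auto
    ultimately show False using nc_crossD[OF assms(1) D Y(1) ac(1,2) x(1) Y(2)] ac ne by auto
  qed
  then show ?thesis unfolding cut_def x_def Y_def by blast
qed

section \<open>Sizes of the unmarked blocks\<close>

text \<open>The marked block is given by one of its points y, which makes it possible to rotate the
  mark and to sum over it.\<close>

definition outer_sizes :: "nat \<Rightarrow> nat set set \<Rightarrow> nat multiset" where
  "outer_sizes y P = image_mset card (mset_set {B \<in> P. y \<notin> B})"

lemma outer_sizes_split_first:
  assumes "nc N Q" "1 < x" "x \<le> N" "x \<in> block Q 1"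
  shows "outer_sizes 1 (split_first x Q) = add_mset (card (block Q 1 \<inter> {x..})) (outer_sizes 1 Q)"
  unfolding outer_sizes_def nc_split_first(5)[OF assms(2,3,1,4)]
  using nc_split_first(6)[OF assms(2,3,1,4)] nc_finite[OF assms(1)] by simp

text \<open>The size of the marked block is thus a function of N and the other sizes; it becomes the
  multiplicity in the double count.\<close>

lemma outer_sizes_sum:
  assumes "nc N P" "y \<in> {1..N}"
  shows "card (block P y) + \<Sum>\<^sub># (outer_sizes y P) = N"
proof -
  have fin: "finite P" by (rule nc_finite[OF assms(1)])
  have P: "P = insert (block P y) {B \<in> P. y \<notin> B}"
    using block_mem[OF assms] block_eq[OF assms(1)] by blast
  have "N = card (\<Union>P)" using assms(1) unfolding nc_def partition_on_def by simp
  also have "\<dots> = (\<Sum>B\<in>P. card B)"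
    using assms(1) nc_finite_block[OF assms(1)] unfolding nc_def partition_on_def disjoint_def
    by (intro card_Union_disjoint) (auto simp: pairwise_def disjnt_def)
  also have "\<dots> = card (block P y) + (\<Sum>B\<in>{B \<in> P. y \<notin> B}. card B)"
    by (subst P, subst sum.insert) (use fin block_mem[OF assms] in auto)
  also have "(\<Sum>B\<in>{B \<in> P. y \<notin> B}. card B) = \<Sum>\<^sub># (outer_sizes y P)"
    unfolding outer_sizes_def by (simp add: sum_unfold_sum_mset)
  finally show ?thesis by simp
qed

text \<open>On Z the map sending x to the size of Z \<inter> {x..} is strictly decreasing, hence a
  bijection onto {1..card Z}. This is why the size m alone records the cutting point.\<close>

lemma top_segment:
  fixes Z :: "nat set"
  assumes "finite Z" "0 < m" "m \<le> card Z"
  shows "\<exists>!x. x \<in> Z \<and> card (Z \<inter> {x..}) = m"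
proof -
  have mono: "card (Z \<inter> {y..}) < card (Z \<inter> {x..})" if "x \<in> Z" "y \<in> Z" "x < y" for x y
  proof (rule psubset_card_mono)
    have "x \<in> Z \<inter> {x..}" "x \<notin> Z \<inter> {y..}" "Z \<inter> {y..} \<subseteq> Z \<inter> {x..}" using that by auto
    then show "Z \<inter> {y..} \<subset> Z \<inter> {x..}" by blast
  qed (use assms in simp)
  then have inj: "inj_on (\<lambda>x. card (Z \<inter> {x..})) Z"
    by (metis (mono_tags, lifting) inj_onI less_irrefl linorder_less_linear)
  have "(\<lambda>x. card (Z \<inter> {x..})) ` Z \<subseteq> {1..card Z}"
  proof
    fix i assume "i \<in> (\<lambda>x. card (Z \<inter> {x..})) ` Z"
    then obtain x where x: "x \<in> Z" "i = card (Z \<inter> {x..})" by auto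
    have "i \<le> card Z" unfolding x by (intro card_mono) (use assms in auto)
    moreover have "i > 0" unfolding x card_gt_0_iff using x assms by auto
    ultimately show "i \<in> {1..card Z}" by simp
  qed
  then have "(\<lambda>x. card (Z \<inter> {x..})) ` Z = {1..card Z}"
    by (intro card_subset_eq) (auto simp: card_image[OF inj])
  then obtain x where "x \<in> Z" "card (Z \<inter> {x..}) = m" using assms by (metis (no_types, lifting) One_nat_def Suc_leI atLeastAtMost_iff imageE)
  then show ?thesis using inj unfolding inj_on_def by blast
qed

section \<open>Chains and the merging recursion\<close>

definition nc_chains :: "nat \<Rightarrow> nat \<Rightarrow> nat set set list set" where
  "nc_chains N l = {cs. length cs = l \<and> (\<forall>j<l. nc N (cs ! j)) \<and>
     (\<forall>j. Suc j < l \<longrightarrow> refines (cs ! j) (cs ! Suc j))}"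

lemma nc_chains_refines:
  assumes "cs \<in> nc_chains N l" "i \<le> j" "j < l"
  shows "refines (cs ! i) (cs ! j)"
  using assms(2,3)
proof (induction j rule: dec_induct)
  case base
  show ?case by (rule refines_refl)
next
  case (step j)
  then show ?case using assms(1) refines_trans unfolding nc_chains_def by (metis (mono_tags, lifting) Suc_lessD mem_Collect_eq)
qed

lemma finite_nc_chains: "finite (nc_chains N l)"
proof (rule finite_subset)
  show "nc_chains N l \<subseteq> {cs. set cs \<subseteq> Pow (Pow {1..N}) \<and> length cs = l}"
    using nc_subset unfolding nc_chains_def by (fastforce simp: in_set_conv_nth)
qed (simp add: finite_lists_length_eq)

text \<open>Levels are counted from 0, and \<open>s i\<close> is the drop in the number of blocks from level \<open>i\<close> to level
  \<open>i + 1\<close>, where level \<open>l\<close> stands for the one-block partition.\<close>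

definition typed_chains ::
  "nat \<Rightarrow> nat \<Rightarrow> nat \<Rightarrow> nat multiset \<Rightarrow> (nat \<Rightarrow> nat) \<Rightarrow> nat set set list set" where
  "typed_chains N l y \<beta> s = {cs \<in> nc_chains N l. outer_sizes y (cs ! 0) = \<beta> \<and>
     (\<forall>j<l. card (cs ! j) = Suc (\<Sum>i=j..<l. s i))}"

text \<open>In a refinement chain N stays with 1 once it has joined it, so J is a threshold: J = l
  imposes nothing, J = 0 asks for the link at every level.\<close>

definition linked_chains ::
  "nat \<Rightarrow> nat \<Rightarrow> nat \<Rightarrow> nat multiset \<Rightarrow> (nat \<Rightarrow> nat) \<Rightarrow> nat set set list set" where
  "linked_chains N l J \<beta> s =
     {cs \<in> typed_chains N l 1 \<beta> s. \<forall>j. J \<le> j \<and> j < l \<longrightarrow> N \<in> block (cs ! j) 1}"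

lemma finite_typed_chains: "finite (typed_chains N l y \<beta> s)"
  unfolding typed_chains_def using finite_nc_chains by simp

lemma finite_linked_chains: "finite (linked_chains N l J \<beta> s)"
  unfolding linked_chains_def using finite_typed_chains by simp

lemma linked_chains_full: "linked_chains N l l \<beta> s = typed_chains N l 1 \<beta> s"
  unfolding linked_chains_def by auto

section \<open>Merging and splitting along a chain\<close>

definition join_upto :: "nat \<Rightarrow> nat \<Rightarrow> nat set set list \<Rightarrow> nat set set list" where
  "join_upto J x cs = map (\<lambda>j. if j \<le> J then join_first x (cs ! j) else cs ! j) [0..<length cs]"

definition split_upto :: "nat \<Rightarrow> nat \<Rightarrow> nat set set list \<Rightarrow> nat set set list" where
  "split_upto J x cs = map (\<lambda>j. if j \<le> J then split_first x (cs ! j) else cs ! j) [0..<length cs]"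

context
  fixes N l J :: nat
  assumes N: "1 \<le> N" and J: "J < l"
begin

text \<open>The cut at level J is inherited by all finer levels, so every merge up to J is
  reversible. These levels lose one block each and the later ones none, hence only the drop
  \<open>s J\<close> changes, by one. Level 0 always takes part, so exactly one size m leaves
  \<beta>.\<close>

lemma join_upto_linked:
  assumes cs: "cs \<in> linked_chains N l (Suc J) \<beta> s" and nin: "N \<notin> block (cs ! J) 1"
    and x: "x = Min (block (cs ! J) N)" and m: "m = card (block (cs ! 0) x)"
  shows "1 < x" "x \<le> N" "m \<in># \<beta>" "0 < s J"
    and "join_upto J x cs \<in> linked_chains N l J (\<beta> - {#m#}) (s(J := s J - 1))"
    and "split_upto J x (join_upto J x cs) = cs"
    and "x \<in> block (join_upto J x cs ! 0) 1" "card (block (join_upto J x cs ! 0) 1 \<inter> {x..}) = m"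
proof -
  have ch: "cs \<in> nc_chains N l" and len: "length cs = l" and nc: "\<And>j. j < l \<Longrightarrow> nc N (cs ! j)"
    and beta: "outer_sizes 1 (cs ! 0) = \<beta>"
    and crd: "\<And>j. j < l \<Longrightarrow> card (cs ! j) = Suc (\<Sum>i=j..<l. s i)"
    and lnk: "\<And>j. J < j \<Longrightarrow> j < l \<Longrightarrow> N \<in> block (cs ! j) 1"
    using cs unfolding linked_chains_def typed_chains_def nc_chains_def by auto
  have ref: "refines (cs ! i) (cs ! j)" if "i \<le> j" "j < l" for i j
    using nc_chains_refines[OF ch that] .
  have Y: "block (cs ! J) N \<in> cs ! J" "N \<in> block (cs ! J) N"
    using block_mem[OF nc[OF J], of N] N by auto
  have xY: "x \<in> block (cs ! J) N" unfolding x using nc_finite_block[OF nc[OF J] Y(1)] Y(2) by (intro Min_in) auto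
  have xN: "x \<in> {1..N}" using xY nc_subset[OF nc[OF J] Y(1)] by blast
  have bx: "block (cs ! J) x = block (cs ! J) N" using block_mem_iff[OF nc[OF J] _ xY] N by auto
  have "x \<noteq> 1" using nin bx Y by auto
  then show x1: "1 < x" and xn: "x \<le> N" using xN by auto
  have cutJ: "cut x (cs ! J)" unfolding x by (rule cut_Min_block[OF nc[OF J] N])
  have cuts: "cut x (cs ! j)" if "j \<le> J" for j using cut_mono[OF ref[OF that J] cutJ] .
  note nj = nc_join_first[OF x1 xn nc cuts]
  define ds where "ds = join_upto J x cs"
  have dlen: "length ds = l" unfolding ds_def join_upto_def using len by simp
  have dj: "ds ! j = join_first x (cs ! j)" if "j \<le> J" for j
    using that J len unfolding ds_def join_upto_def by simp
  have dj': "ds ! j = cs ! j" if "J < j" "j < l" for j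
    using that J len unfolding ds_def join_upto_def by simp
  have dnc: "nc N (ds ! j)" if "j < l" for j
    using that nj(1)[of j] nc[OF that] dj dj' by (cases "j \<le> J") auto
  have xblk: "x \<in> block (join_first x (cs ! j)) 1" if "j \<le> J" for j
    using nj(2)[of j] that J block_mem[OF nc, of j x] xN by auto
  have dref: "refines (ds ! j) (ds ! Suc j)" if "Suc j < l" for j
  proof -
    consider "Suc j \<le> J" | "j = J" | "J < j" by linarith
    then show ?thesis
    proof cases
      case 1
      have "refines (cs ! j) (join_first x (cs ! Suc j))"
        using refines_trans[OF ref refines_join_first] that by auto
      then show ?thesis unfolding dj[OF 1] dj[OF Suc_leD[OF 1]]
        using join_first_refines[OF nc _ N xN _ xblk[OF 1], of j] nj(1)[of "Suc j"] 1 that by auto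
    next
      \<comment> \<open>Border between merged and unmerged levels: at level J + 1 the element x is
        with N and N is with 1, so x is already with 1.\<close>
      case 2
      have "block (cs ! J) x \<subseteq> block (cs ! Suc J) x"
        using refines_block[OF nc nc ref xN, of J "Suc J"] that 2 by auto
      then have "N \<in> block (cs ! Suc J) x" using bx Y by auto
      moreover have "N \<in> block (cs ! Suc J) 1" using lnk[of "Suc J"] that 2 by auto
      ultimately have "block (cs ! Suc J) x = block (cs ! Suc J) 1"
        using block_mem_iff[OF nc, of "Suc J" x N] block_mem_iff[OF nc, of "Suc J" 1 N] xN N that 2 by auto
      then have "x \<in> block (cs ! Suc J) 1" using block_mem[OF nc xN] that 2 by metis
      then show ?thesis
        using join_first_refines[OF nc nc N xN ref, of J "Suc J"] dj[of J] dj'[of "Suc J"] that 2 by auto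
    next
      case 3
      then show ?thesis using dj' ref that by auto
    qed
  qed
  have dch: "ds \<in> nc_chains N l" unfolding nc_chains_def using dlen dnc dref by auto
  have c: "card (cs ! j) = Suc (card (ds ! j))" if "j \<le> J" for j
    using nj(3)[of j] that J dj by auto
  \<comment> \<open>After the merge level J still refines level J + 1 but has one block less, which
    excludes a zero drop. For J = l - 1 a zero drop would mean a single block, and the merge would
    leave none.\<close>
  show sJ: "0 < s J"
  proof (rule ccontr)
    assume "\<not> 0 < s J"
    then have z: "(\<Sum>i=J..<l. s i) = (\<Sum>i=Suc J..<l. s i)" using J by (simp add: sum.atLeast_Suc_lessThan)
    show False
    proof (cases "Suc J < l")
      case True
      have "card (cs ! Suc J) \<le> card (ds ! J)"
        using refines_card[OF dnc dnc dref[OF True]] True dj'[of "Suc J"] by auto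
      then show ?thesis using c[of J] crd[of J] crd[of "Suc J"] z True by simp
    next
      case False
      then have "card (cs ! J) = 1" using z crd[of J] J by simp
      then have "card (ds ! J) = 0" using c[of J] by simp
      moreover have "block (ds ! J) 1 \<in> ds ! J" using block_mem[OF dnc[OF J]] N by auto
      ultimately show ?thesis using nc_finite[OF dnc[OF J]] by auto
    qed
  qed
  have dcrd: "card (ds ! j) = Suc (\<Sum>i=j..<l. (s(J := s J - 1)) i)" if "j < l" for j
  proof (cases "j \<le> J")
    case True
    have sum: "(\<Sum>i=j..<l. f i) = f J + (\<Sum>i\<in>{j..<l} - {J}. f i)" for f :: "nat \<Rightarrow> nat"
      using True J by (simp add: sum.remove)
    show ?thesis using c[OF True] crd[OF that] sJ unfolding sum by simp
  next
    case False
    have "(\<Sum>i=j..<l. (s(J := s J - 1)) i) = (\<Sum>i=j..<l. s i)"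
      by (intro sum.cong) (use False in auto)
    then show ?thesis using dj' crd that False by simp
  qed
  have d0: "ds ! 0 = join_first x (cs ! 0)" using dj by simp
  have nc0: "nc N (ds ! 0)" using dnc J by auto
  have b0: "x \<in> block (ds ! 0) 1" using xblk[of 0] d0 by simp
  have sp0: "split_first x (ds ! 0) = cs ! 0" using nj(4)[of 0] J d0 by simp
  have m0: "card (block (ds ! 0) 1 \<inter> {x..}) = m" using nj(5)[of 0] J d0 m by simp
  have "\<beta> = add_mset m (outer_sizes 1 (ds ! 0))"
    using outer_sizes_split_first[OF nc0 x1 xn b0] sp0 beta m0 by simp
  then show "m \<in># \<beta>" by simp
  have ob: "outer_sizes 1 (ds ! 0) = \<beta> - {#m#}"
    using \<open>\<beta> = add_mset m (outer_sizes 1 (ds ! 0))\<close> by simp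
  have dl: "N \<in> block (ds ! j) 1" if "J \<le> j" "j < l" for j
  proof (cases "j = J")
    case True
    then show ?thesis using nj(2)[of J] J dj[of J] bx Y by auto
  next
    case False
    then show ?thesis using that dj' lnk by auto
  qed
  show "join_upto J x cs \<in> linked_chains N l J (\<beta> - {#m#}) (s(J := s J - 1))"
    unfolding ds_def[symmetric] linked_chains_def typed_chains_def using dch ob dcrd dl by auto
  have "split_upto J x ds ! j = cs ! j" if "j < l" for j
    using that dlen dj dj' nj(4)[of j] unfolding split_upto_def by auto
  then show "split_upto J x (join_upto J x cs) = cs"
    unfolding ds_def[symmetric] by (intro nth_equalityI) (auto simp: split_upto_def dlen len)
  show "x \<in> block (join_upto J x cs ! 0) 1" "card (block (join_upto J x cs ! 0) 1 \<inter> {x..}) = m"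
    unfolding ds_def[symmetric] by (rule b0, rule m0)
qed

text \<open>Since x is with 1 at level 0, it is so at every level. Splitting at x separates N from 1
  at level J, and the upper piece there is the whole block of N with least element x, so the cutting
  point is read off again.\<close>

lemma split_upto_linked:
  assumes ds: "ds \<in> linked_chains N l J (\<beta> - {#m#}) (s(J := s J - 1))"
    and m: "m \<in># \<beta>" and sJ: "0 < s J"
    and x: "1 < x" "x \<in> block (ds ! 0) 1" "card (block (ds ! 0) 1 \<inter> {x..}) = m"
  defines "cs \<equiv> split_upto J x ds"
  shows "cs \<in> linked_chains N l (Suc J) \<beta> s"
    and "N \<notin> block (cs ! J) 1"
    and "x = Min (block (cs ! J) N)" "card (block (cs ! 0) x) = m"
    and "join_upto J x cs = ds"
proof -
  have ch: "ds \<in> nc_chains N l" and len: "length ds = l" and nc: "\<And>j. j < l \<Longrightarrow> nc N (ds ! j)"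
    and beta: "outer_sizes 1 (ds ! 0) = \<beta> - {#m#}"
    and crd: "\<And>j. j < l \<Longrightarrow> card (ds ! j) = Suc (\<Sum>i=j..<l. (s(J := s J - 1)) i)"
    and lnk: "\<And>j. J \<le> j \<Longrightarrow> j < l \<Longrightarrow> N \<in> block (ds ! j) 1"
    using ds unfolding linked_chains_def typed_chains_def nc_chains_def by auto
  have ref: "refines (ds ! i) (ds ! j)" if "i \<le> j" "j < l" for i j
    using nc_chains_refines[OF ch that] .
  have l0: "0 < l" using J by auto
  have "block (ds ! 0) 1 \<in> ds ! 0" using block_mem[OF nc[OF l0]] N by auto
  then have xN: "x \<in> {1..N}" using nc_subset[OF nc[OF l0]] x(2) by blast
  then have xn: "x \<le> N" by simp
  have xb: "x \<in> block (ds ! j) 1" if "j < l" for j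
    using refines_block[OF nc nc ref, of 0 j 1] x(2) N that by auto
  note ns = nc_split_first[OF x(1) xn nc xb]
  have clen: "length cs = l" unfolding cs_def split_upto_def using len by simp
  have cj: "cs ! j = split_first x (ds ! j)" if "j \<le> J" for j
    using that J len unfolding cs_def split_upto_def by simp
  have cj': "cs ! j = ds ! j" if "J < j" "j < l" for j
    using that J len unfolding cs_def split_upto_def by simp
  have cnc: "nc N (cs ! j)" if "j < l" for j
    using that ns(1)[of j] nc[OF that] cj cj' by (cases "j \<le> J") auto
  have cref: "refines (cs ! j) (cs ! Suc j)" if "Suc j < l" for j
  proof -
    have a: "refines (split_first x (ds ! j)) (ds ! Suc j)"
      using refines_trans[OF split_first_refines ref, of N j "Suc j" x] nc N that by auto
    consider "Suc j \<le> J" | "j = J" | "J < j" by linarith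
    then show ?thesis
    proof cases
      case 1
      have "refines (split_first x (ds ! j)) (split_first x (ds ! Suc j))"
        by (rule refines_split_first[OF a cut_split_first[OF x(1) xn nc xb]]) (use that in auto)
      then show ?thesis using cj 1 by auto
    next
      case 2
      then show ?thesis using a cj cj' that by auto
    next
      case 3
      then show ?thesis using cj' ref that by auto
    qed
  qed
  have cch: "cs \<in> nc_chains N l" unfolding nc_chains_def using clen cnc cref by auto
  have ccrd: "card (cs ! j) = Suc (\<Sum>i=j..<l. s i)" if "j < l" for j
  proof (cases "j \<le> J")
    case True
    have sum: "(\<Sum>i=j..<l. f i) = f J + (\<Sum>i\<in>{j..<l} - {J}. f i)" for f :: "nat \<Rightarrow> nat"
      using True J by (simp add: sum.remove)
    show ?thesis using ns(4)[OF that that] cj[OF True] crd[OF that] sJ unfolding sum by simp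
  next
    case False
    have "(\<Sum>i=j..<l. (s(J := s J - 1)) i) = (\<Sum>i=j..<l. s i)"
      by (intro sum.cong) (use False in auto)
    then show ?thesis using cj' crd that False by simp
  qed
  have cb: "outer_sizes 1 (cs ! 0) = \<beta>"
    using outer_sizes_split_first[OF nc[OF l0] x(1) xn x(2)] beta x(3) m cj[of 0] by simp
  have cl: "N \<in> block (cs ! j) 1" if "Suc J \<le> j" "j < l" for j
    using that cj' lnk by auto
  show "cs \<in> linked_chains N l (Suc J) \<beta> s"
    unfolding linked_chains_def typed_chains_def using cch cb ccrd cl by auto
  have bJ: "block (cs ! J) 1 = block (ds ! J) 1 \<inter> {..<x}" "block (cs ! J) x = block (ds ! J) 1 \<inter> {x..}"
    using ns(2,3)[of J] J cj by auto
  have "N \<in> block (ds ! J) 1" using lnk J by auto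
  then have NJ: "N \<in> block (cs ! J) x" using bJ xn by auto
  show "N \<notin> block (cs ! J) 1" using bJ xn by auto
  have bN: "block (cs ! J) N = block (ds ! J) 1 \<inter> {x..}"
    using block_mem_iff[OF cnc[OF J] xN NJ] bJ by simp
  have "finite (block (cs ! J) N)" using nc_finite_block[OF cnc[OF J]] block_mem[OF cnc[OF J], of N] N by auto
  then show "x = Min (block (cs ! J) N)"
    unfolding bN using xb[OF J] by (intro Min_eqI[symmetric]) auto
  show "card (block (cs ! 0) x) = m" using ns(3)[of 0] l0 cj[of 0] x(3) by simp
  have "join_upto J x cs ! j = ds ! j" if "j < l" for j
    using that clen cj cj' join_split_first[OF x(1) xn nc xb, of j] unfolding join_upto_def by auto
  then show "join_upto J x cs = ds"
    by (intro nth_equalityI) (auto simp: join_upto_def clen len)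
qed

lemma card_linked_chains_peel:
  assumes "m \<in># \<beta>" "0 \<notin># \<beta>" "\<Sum>\<^sub># \<beta> < N" "0 < s J"
  shows "card {cs \<in> linked_chains N l (Suc J) \<beta> s. N \<notin> block (cs ! J) 1 \<and>
             card (block (cs ! 0) (Min (block (cs ! J) N))) = m}
         = card (linked_chains N l J (\<beta> - {#m#}) (s(J := s J - 1)))" (is "card ?E = card ?F")
proof -
  define pos where "pos ds = (THE x. x \<in> block (ds ! 0) 1 \<and> card (block (ds ! 0) 1 \<inter> {x..}) = m)"
    for ds :: "nat set set list"
  have m: "0 < m" using assms(1,2) by (cases m) auto
  have l0: "0 < l" using J by simp
  have top: "\<exists>!x. x \<in> block (ds ! 0) 1 \<and> card (block (ds ! 0) 1 \<inter> {x..}) = m"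
    "card (block (ds ! 0) 1 \<inter> {1..}) \<noteq> m" "0 \<notin> block (ds ! 0) 1" if "ds \<in> ?F" for ds
  proof -
    have nc: "nc N (ds ! 0)" and o: "outer_sizes 1 (ds ! 0) = \<beta> - {#m#}"
      using that l0 unfolding linked_chains_def typed_chains_def nc_chains_def by auto
    have b: "block (ds ! 0) 1 \<in> ds ! 0" using block_mem[OF nc] N by auto
    have "\<Sum>\<^sub># (add_mset m (\<beta> - {#m#})) = m + \<Sum>\<^sub># (\<beta> - {#m#})" by simp
    then have "\<Sum>\<^sub># \<beta> = m + \<Sum>\<^sub># (\<beta> - {#m#})" using assms(1) by simp
    moreover have "card (block (ds ! 0) 1) + \<Sum>\<^sub># (\<beta> - {#m#}) = N"
      using outer_sizes_sum[OF nc, of 1] o N by auto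
    \<comment> \<open>The strict bound on the sum of \<beta> leaves the merged block of 1 with more
      than m elements, so the cutting point differs from 1 and a nonempty piece stays with
      1.\<close>
    ultimately have lt: "m < card (block (ds ! 0) 1)" using assms(3) by linarith
    then show "\<exists>!x. x \<in> block (ds ! 0) 1 \<and> card (block (ds ! 0) 1 \<inter> {x..}) = m"
      using top_segment[OF nc_finite_block[OF nc b] m] by simp
    have "block (ds ! 0) 1 \<inter> {1..} = block (ds ! 0) 1" "0 \<notin> block (ds ! 0) 1"
      using nc_subset[OF nc b] by auto
    then show "card (block (ds ! 0) 1 \<inter> {1..}) \<noteq> m" "0 \<notin> block (ds ! 0) 1" using lt by auto
  qed
  have pos: "1 < pos ds" "pos ds \<in> block (ds ! 0) 1" "card (block (ds ! 0) 1 \<inter> {pos ds..}) = m"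
    if "ds \<in> ?F" for ds
  proof -
    show p: "pos ds \<in> block (ds ! 0) 1" "card (block (ds ! 0) 1 \<inter> {pos ds..}) = m"
      using theI'[OF top(1)[OF that]] unfolding pos_def by auto
    have "pos ds \<noteq> 0" using p(1) top(3)[OF that] by metis
    moreover have "pos ds \<noteq> 1" using p(2) top(2)[OF that] by metis
    ultimately show "1 < pos ds" by simp
  qed
  have "bij_betw (\<lambda>cs. join_upto J (Min (block (cs ! J) N)) cs) ?E ?F"
  proof (rule bij_betw_byWitness[where f' = "\<lambda>ds. split_upto J (pos ds) ds"])
    show "\<forall>cs\<in>?E. split_upto J (pos (join_upto J (Min (block (cs ! J) N)) cs)) (join_upto J (Min (block (cs ! J) N)) cs) = cs"
    proof
      fix cs assume cs: "cs \<in> ?E"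
      define x where "x = Min (block (cs ! J) N)"
      have h: "cs \<in> linked_chains N l (Suc J) \<beta> s" "N \<notin> block (cs ! J) 1" "m = card (block (cs ! 0) x)"
        using cs unfolding x_def by auto
      note j = join_upto_linked[OF h(1,2) x_def h(3)]
      have "pos (join_upto J x cs) = x" unfolding pos_def
        by (rule the1_equality[OF top(1)[OF j(5)]]) (use j(7,8) in simp)
      then show "split_upto J (pos (join_upto J (Min (block (cs ! J) N)) cs)) (join_upto J (Min (block (cs ! J) N)) cs) = cs"
        using j(6) unfolding x_def[symmetric] by simp
    qed
    show "\<forall>ds\<in>?F. join_upto J (Min (block (split_upto J (pos ds) ds ! J) N)) (split_upto J (pos ds) ds) = ds"
    proof
      fix ds assume ds: "ds \<in> ?F"
      note s = split_upto_linked[OF ds assms(1,4) pos[OF ds]]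
      show "join_upto J (Min (block (split_upto J (pos ds) ds ! J) N)) (split_upto J (pos ds) ds) = ds"
        using s(5) unfolding s(3)[symmetric] .
    qed
    show "(\<lambda>cs. join_upto J (Min (block (cs ! J) N)) cs) ` ?E \<subseteq> ?F"
      using join_upto_linked(5) by auto
    show "(\<lambda>ds. split_upto J (pos ds) ds) ` ?F \<subseteq> ?E"
    proof
      fix cs assume "cs \<in> (\<lambda>ds. split_upto J (pos ds) ds) ` ?F"
      then obtain ds where ds: "ds \<in> ?F" "cs = split_upto J (pos ds) ds" by blast
      note s = split_upto_linked[OF ds(1) assms(1,4) pos[OF ds(1)], folded ds(2)]
      show "cs \<in> ?E" using s(1,2,4) s(3) by simp
    qed
  qed
  then show ?thesis by (rule bij_betw_same_card)
qed

text \<open>Either N is with 1 at level J already, or the chain is classified by the peeled size m.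
  The sum runs over distinct sizes: m alone determines the inverse, so multiplicities in \<beta> do
  not enter here.\<close>

lemma card_linked_chains_Suc:
  assumes "0 \<notin># \<beta>" "\<Sum>\<^sub># \<beta> < N"
  shows "card (linked_chains N l (Suc J) \<beta> s) = card (linked_chains N l J \<beta> s) +
    (if s J = 0 then 0 else \<Sum>m\<in>set_mset \<beta>. card (linked_chains N l J (\<beta> - {#m#}) (s(J := s J - 1))))"
proof -
  define E where "E m = {cs \<in> linked_chains N l (Suc J) \<beta> s. N \<notin> block (cs ! J) 1 \<and>
             card (block (cs ! 0) (Min (block (cs ! J) N))) = m}" for m
  define U where "U = {cs \<in> linked_chains N l (Suc J) \<beta> s. N \<notin> block (cs ! J) 1}"
  have fin: "finite U" "finite (linked_chains N l J \<beta> s)" unfolding U_def using finite_linked_chains by auto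
  have eq: "linked_chains N l (Suc J) \<beta> s = linked_chains N l J \<beta> s \<union> U"
  proof -
    have "(\<forall>j. J \<le> j \<and> j < l \<longrightarrow> N \<in> block (cs ! j) 1) \<longleftrightarrow>
        (\<forall>j. Suc J \<le> j \<and> j < l \<longrightarrow> N \<in> block (cs ! j) 1) \<and> N \<in> block (cs ! J) 1" for cs
      using J by (metis Suc_leI Suc_le_lessD le_neq_implies_less less_imp_le_nat order_refl)
    then show ?thesis unfolding U_def linked_chains_def by auto
  qed
  moreover have "linked_chains N l J \<beta> s \<inter> U = {}" unfolding U_def linked_chains_def using J by auto
  ultimately have c: "card (linked_chains N l (Suc J) \<beta> s) = card (linked_chains N l J \<beta> s) + card U"
    using card_Un_disjoint fin by metis
  have sJ: "0 < s J" if "cs \<in> U" for cs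
    using that join_upto_linked(4)[OF _ _ refl refl, of cs \<beta> s] unfolding U_def by auto
  have "card U = (if s J = 0 then 0 else \<Sum>m\<in>set_mset \<beta>. card (E m))"
  proof (cases "s J = 0")
    case True
    then have "U = {}" using sJ by auto
    then show ?thesis using True by simp
  next
    case False
    have "U = (\<Union>m\<in>set_mset \<beta>. E m)"
      unfolding U_def E_def using join_upto_linked(3)[OF _ _ refl refl, of _ \<beta> s] by auto
    also have "card \<dots> = (\<Sum>m\<in>set_mset \<beta>. card (E m))"
      by (rule card_UN_disjoint) (auto simp: E_def finite_linked_chains)
    finally show ?thesis using False by simp
  qed
  then show ?thesis using c card_linked_chains_peel[OF _ assms] unfolding E_def by (auto intro: sum.cong)
qed

end

section \<open>Deleting the largest element\<close>

definition drop_max :: "nat \<Rightarrow> nat set set \<Rightarrow> nat set set" where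
  "drop_max N P = insert (block P 1 - {N}) (P - {block P 1})"

definition add_max :: "nat \<Rightarrow> nat set set \<Rightarrow> nat set set" where
  "add_max N P = insert (insert N (block P 1)) (P - {block P 1})"

context
  fixes N :: nat
  assumes N: "1 \<le> N"
begin

text \<open>On the circle \<open>Suc N\<close> is a neighbour of 1, so a crossing through
  \<open>Suc N\<close> could be moved to one through 1, which is in the same block.\<close>

lemma nc_add_max:
  assumes "nc N Q"
  shows "nc (Suc N) (add_max (Suc N) Q)"
    and "block (add_max (Suc N) Q) 1 = insert (Suc N) (block Q 1)"
    and "drop_max (Suc N) (add_max (Suc N) Q) = Q"
    and "card (add_max (Suc N) Q) = card Q"
    and "outer_sizes 1 (add_max (Suc N) Q) = outer_sizes 1 Q"
proof -
  define Z where "Z = block Q 1"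
  have Z: "Z \<in> Q" "1 \<in> Z" using block_mem[OF assms] N unfolding Z_def by auto
  have sub: "\<And>D. D \<in> Q \<Longrightarrow> D \<subseteq> {1..N}" using nc_subset[OF assms] .
  have nN: "Suc N \<notin> D" if "D \<in> Q" for D using sub[OF that] by auto
  have disj: "\<And>D. D \<in> Q \<Longrightarrow> D \<noteq> Z \<Longrightarrow> D \<inter> Z = {}" using nc_disj[OF assms] Z by blast
  have A: "add_max (Suc N) Q = insert (insert (Suc N) Z) (Q - {Z})" unfolding add_max_def Z_def ..
  have part: "partition_on {1..Suc N} (add_max (Suc N) Q)"
    unfolding partition_on_def
  proof (intro conjI)
    have "\<Union>Q = {1..N}" using assms unfolding nc_def partition_on_def by blast
    moreover have "\<Union>(add_max (Suc N) Q) = insert (Suc N) (\<Union>Q)" unfolding A using Z by auto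
    moreover have "{1..Suc N} = insert (Suc N) {1..N}" by auto
    ultimately show "\<Union>(add_max (Suc N) Q) = {1..Suc N}" by simp
    show "disjoint (add_max (Suc N) Q)"
    proof (rule disjointI, rule ccontr)
      fix B D assume h: "B \<in> add_max (Suc N) Q" "D \<in> add_max (Suc N) Q" "B \<noteq> D" "B \<inter> D \<noteq> {}"
      then obtain y where y: "y \<in> B" "y \<in> D" by blast
      show False
      proof (cases "y \<in> insert (Suc N) Z")
        case True
        then have "B = insert (Suc N) Z" "D = insert (Suc N) Z"
          using h(1,2) y disj nN unfolding A by blast+
        then show ?thesis using h(3) by simp
      next
        case False
        then have "B \<in> Q" "D \<in> Q" using h(1,2) y unfolding A by blast+
        then show ?thesis using nc_disj[OF assms] y h(3) by blast
      qed
    qed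
    have "{} \<notin> Q" using nc_nonempty[OF assms] by blast
    then show "{} \<notin> add_max (Suc N) Q" unfolding A by auto
  qed
  have "noncrossing (add_max (Suc N) Q)"
    unfolding noncrossing_def
  proof (rule notI, elim exE conjE)
    fix a b c d B D
    assume h: "a < b" "b < c" "c < d" "B \<in> add_max (Suc N) Q" "D \<in> add_max (Suc N) Q" "B \<noteq> D"
      "a \<in> B" "c \<in> B" "b \<in> D" "d \<in> D"
    have dN: "d \<le> Suc N" using h part unfolding partition_on_def by (metis UnionI atLeastAtMost_iff)
    consider "B = insert (Suc N) Z" "D \<in> Q" "D \<noteq> Z" | "D = insert (Suc N) Z" "B \<in> Q" "B \<noteq> Z"
      | "B \<in> Q" "D \<in> Q"
      using h unfolding A by auto
    then show False
    proof cases
      case 1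
      then have "a \<in> Z" "c \<in> Z" using h dN by auto
      then show ?thesis using nc_crossD[OF assms Z(1) 1(2) _ _ h(9,10)] h 1 by auto
    next
      case 2
      then have b: "b \<in> Z" using h dN by auto
      have "a \<noteq> 1" "1 \<le> a" using 2 Z h disj sub[OF 2(2)] by auto
      then have "1 < a" by simp
      then show ?thesis using nc_crossD[OF assms Z(1) 2(2) Z(2) b h(7,8)] h 2 by auto
    next
      case 3
      then show ?thesis using nc_crossD[OF assms 3 h(7-10)] h by auto
    qed
  qed
  with part show nc: "nc (Suc N) (add_max (Suc N) Q)" unfolding nc_def by simp
  show b: "block (add_max (Suc N) Q) 1 = insert (Suc N) (block Q 1)"
    by (rule block_eq[OF nc]) (use A Z Z_def in auto)
  have nin: "insert (Suc N) Z \<notin> Q" using nN by blast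
  have Zm: "insert (Suc N) Z - {Suc N} = Z" using nN Z by auto
  show "drop_max (Suc N) (add_max (Suc N) Q) = Q"
    unfolding drop_max_def b Z_def[symmetric] Zm unfolding A using nin Z by auto
  have "card Q = Suc (card (Q - {Z}))" using Z nc_finite[OF assms] by (metis card_Suc_Diff1)
  then show "card (add_max (Suc N) Q) = card Q"
    unfolding A using nin nc_finite[OF assms] by simp
  have "{B \<in> add_max (Suc N) Q. 1 \<notin> B} = {B \<in> Q. 1 \<notin> B}" unfolding A using Z by auto
  then show "outer_sizes 1 (add_max (Suc N) Q) = outer_sizes 1 Q" unfolding outer_sizes_def by simp
qed

text \<open>Seen as removal of \<open>Suc N\<close> from every block, the deletion passes
  disjointness, noncrossing and refinement on block by block.\<close>

lemma drop_max_eq_image: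
  assumes "nc (Suc N) P" "Suc N \<in> block P 1"
  shows "drop_max (Suc N) P = (\<lambda>B. B - {Suc N}) ` P"
proof -
  have Z: "block P 1 \<in> P" using block_mem[OF assms(1), of 1] by auto
  have id: "D - {Suc N} = D" if "D \<in> P - {block P 1}" for D
    using nc_disj[OF assms(1) _ Z _ assms(2), of D] that by blast
  have "(\<lambda>B. B - {Suc N}) ` P = (\<lambda>B. B - {Suc N}) ` insert (block P 1) (P - {block P 1})"
    using Z by (simp add: insert_absorb)
  also have "\<dots> = insert (block P 1 - {Suc N}) ((\<lambda>B. B - {Suc N}) ` (P - {block P 1}))"
    by (rule image_insert)
  also have "(\<lambda>B. B - {Suc N}) ` (P - {block P 1}) = (\<lambda>B. B) ` (P - {block P 1})"
    by (rule image_cong[OF refl id])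
  finally show ?thesis unfolding drop_max_def by simp
qed

lemma nc_drop_max:
  assumes "nc (Suc N) P" "Suc N \<in> block P 1"
  shows "nc N (drop_max (Suc N) P)" and "add_max (Suc N) (drop_max (Suc N) P) = P"
    and "block (drop_max (Suc N) P) 1 = block P 1 - {Suc N}"
proof -
  define Z where "Z = block P 1"
  have Z: "Z \<in> P" "1 \<in> Z" "Suc N \<in> Z" using block_mem[OF assms(1)] N assms unfolding Z_def by auto
  have disj: "\<And>D. D \<in> P \<Longrightarrow> D \<noteq> Z \<Longrightarrow> D \<inter> Z = {}" using nc_disj[OF assms(1)] Z by blast
  have A: "drop_max (Suc N) P = insert (Z - {Suc N}) (P - {Z})" unfolding drop_max_def Z_def ..
  have eq: "drop_max (Suc N) P = (\<lambda>B. B - {Suc N}) ` P"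
    by (rule drop_max_eq_image[OF assms])
  have part: "partition_on {1..N} (drop_max (Suc N) P)"
    unfolding partition_on_def
  proof (intro conjI)
    have "\<Union>P = {1..Suc N}" using assms unfolding nc_def partition_on_def by blast
    moreover have "\<Union>(drop_max (Suc N) P) = \<Union>P - {Suc N}" unfolding eq by auto
    moreover have "{1..Suc N} - {Suc N} = {1..N}" by auto
    ultimately show "\<Union>(drop_max (Suc N) P) = {1..N}" by simp
    show "disjoint (drop_max (Suc N) P)"
    proof (rule disjointI, rule ccontr)
      fix B D assume h: "B \<in> drop_max (Suc N) P" "D \<in> drop_max (Suc N) P" "B \<noteq> D" "B \<inter> D \<noteq> {}"
      then obtain y B' D' where y: "y \<in> B'" "y \<in> D'" "B' \<in> P" "D' \<in> P" "B = B' - {Suc N}" "D = D' - {Suc N}"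
        unfolding eq by blast
      then show False using nc_disj[OF assms(1)] h(3) by blast
    qed
    have "{} \<notin> P" using nc_nonempty[OF assms(1)] by blast
    moreover have "Z - {Suc N} \<noteq> {}" using Z N by auto
    ultimately show "{} \<notin> drop_max (Suc N) P" unfolding A by auto
  qed
  have "noncrossing (drop_max (Suc N) P)"
    unfolding noncrossing_def
  proof (rule notI, elim exE conjE)
    fix a b c d B D
    assume h: "a < b" "b < c" "c < d" "B \<in> drop_max (Suc N) P" "D \<in> drop_max (Suc N) P" "B \<noteq> D"
      "a \<in> B" "c \<in> B" "b \<in> D" "d \<in> D"
    obtain B' D' where y: "B' \<in> P" "D' \<in> P" "B = B' - {Suc N}" "D = D' - {Suc N}"
      using h unfolding eq by blast
    then show False using nc_crossD[OF assms(1) y(1,2)] h by blast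
  qed
  with part show nc: "nc N (drop_max (Suc N) P)" unfolding nc_def by simp
  show b: "block (drop_max (Suc N) P) 1 = block P 1 - {Suc N}"
    by (rule block_eq[OF nc]) (use A Z Z_def N in auto)
  have "Z - {Suc N} \<notin> P" using disj[of "Z - {Suc N}"] Z N by auto
  moreover have "insert (Suc N) (Z - {Suc N}) = Z" using Z by auto
  ultimately show "add_max (Suc N) (drop_max (Suc N) P) = P"
    unfolding add_max_def b Z_def[symmetric] unfolding A using Z by auto
qed

lemma refines_add_max:
  assumes "nc N P" "nc N Q" "refines P Q"
  shows "refines (add_max (Suc N) P) (add_max (Suc N) Q)"
  unfolding refines_def
proof
  have Q1: "block P 1 \<subseteq> block Q 1" using refines_block[OF assms] N by auto
  fix B assume "B \<in> add_max (Suc N) P"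
  then consider "B = insert (Suc N) (block P 1)" | "B \<in> P" unfolding add_max_def by auto
  then show "\<exists>C\<in>add_max (Suc N) Q. B \<subseteq> C"
  proof cases
    case 1
    then have "B \<subseteq> insert (Suc N) (block Q 1)" using Q1 by auto
    then show ?thesis unfolding add_max_def by auto
  next
    case 2
    then obtain C where C: "C \<in> Q" "B \<subseteq> C" using assms(3) unfolding refines_def by blast
    show ?thesis
    proof (cases "C = block Q 1")
      case True
      then have "B \<subseteq> insert (Suc N) (block Q 1)" using C by auto
      then show ?thesis unfolding add_max_def by auto
    next
      case False
      then have "C \<in> add_max (Suc N) Q" using C unfolding add_max_def by auto
      then show ?thesis using C by blast
    qed
  qed
qed

lemma refines_drop_max:
  assumes "nc (Suc N) P" "Suc N \<in> block P 1" "nc (Suc N) Q" "Suc N \<in> block Q 1" "refines P Q"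
  shows "refines (drop_max (Suc N) P) (drop_max (Suc N) Q)"
  unfolding drop_max_eq_image[OF assms(1,2)] drop_max_eq_image[OF assms(3,4)] refines_def
proof
  fix B assume "B \<in> (\<lambda>B. B - {Suc N}) ` P"
  then obtain B' where B': "B' \<in> P" "B = B' - {Suc N}" by blast
  obtain C where C: "C \<in> Q" "B' \<subseteq> C" using assms(5) B'(1) unfolding refines_def by blast
  have "C - {Suc N} \<in> (\<lambda>B. B - {Suc N}) ` Q" "B \<subseteq> C - {Suc N}" using B' C by auto
  then show "\<exists>C\<in>(\<lambda>B. B - {Suc N}) ` Q. B \<subseteq> C" by blast
qed

text \<open>At every level only the block of 1 shrinks, and it keeps 1; block numbers and the sizes
  of the other blocks are unchanged.\<close>

lemma card_linked_chains_0:
  assumes "0 < l"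
  shows "card (linked_chains (Suc N) l 0 \<beta> s) = card (linked_chains N l l \<beta> s)"
proof -
  have "bij_betw (map (add_max (Suc N))) (linked_chains N l l \<beta> s) (linked_chains (Suc N) l 0 \<beta> s)"
  proof (rule bij_betw_byWitness[where f' = "map (drop_max (Suc N))"])
    show "\<forall>cs\<in>linked_chains N l l \<beta> s. map (drop_max (Suc N)) (map (add_max (Suc N)) cs) = cs"
      using nc_add_max(3) unfolding linked_chains_def typed_chains_def nc_chains_def
      by (auto intro!: nth_equalityI)
    show "\<forall>cs\<in>linked_chains (Suc N) l 0 \<beta> s. map (add_max (Suc N)) (map (drop_max (Suc N)) cs) = cs"
      using nc_drop_max(2) unfolding linked_chains_def typed_chains_def nc_chains_def
      by (auto intro!: nth_equalityI)
    show "map (add_max (Suc N)) ` linked_chains N l l \<beta> s \<subseteq> linked_chains (Suc N) l 0 \<beta> s"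
      using nc_add_max refines_add_max assms
      unfolding linked_chains_def typed_chains_def nc_chains_def by auto
    show "map (drop_max (Suc N)) ` linked_chains (Suc N) l 0 \<beta> s \<subseteq> linked_chains N l l \<beta> s"
    proof
      fix ds assume "ds \<in> map (drop_max (Suc N)) ` linked_chains (Suc N) l 0 \<beta> s"
      then obtain cs where ds: "ds = map (drop_max (Suc N)) cs" and cs: "cs \<in> linked_chains (Suc N) l 0 \<beta> s" by blast
      have len: "length cs = l" and nc: "\<And>j. j < l \<Longrightarrow> nc (Suc N) (cs ! j)"
        and ref: "\<And>j. Suc j < l \<Longrightarrow> refines (cs ! j) (cs ! Suc j)"
        and o: "outer_sizes 1 (cs ! 0) = \<beta>"
        and crd: "\<And>j. j < l \<Longrightarrow> card (cs ! j) = Suc (\<Sum>i=j..<l. s i)"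
        and lnk: "\<And>j. j < l \<Longrightarrow> Suc N \<in> block (cs ! j) 1"
        using cs unfolding linked_chains_def typed_chains_def nc_chains_def by auto
      have a: "card (drop_max (Suc N) (cs ! j)) = card (cs ! j)"
        "outer_sizes 1 (drop_max (Suc N) (cs ! j)) = outer_sizes 1 (cs ! j)" if "j < l" for j
        using nc_add_max(4,5)[OF nc_drop_max(1)[OF nc lnk]] nc_drop_max(2)[OF nc lnk] that by metis+
      show "ds \<in> linked_chains N l l \<beta> s"
        unfolding linked_chains_def typed_chains_def nc_chains_def
        using len assms a[of 0] a(1) o crd nc_drop_max(1)[OF nc lnk] refines_drop_max[OF nc lnk nc lnk ref]
        unfolding ds by auto
    qed
  qed
  then show ?thesis by (simp add: bij_betw_same_card)
qed

end

section \<open>Solving the recursion\<close>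

lemma sum_count_mult:
  fixes f :: "'a \<Rightarrow> real"
  shows "(\<Sum>m\<in>set_mset \<beta>. real (count \<beta> m) * f m) = \<Sum>\<^sub># (image_mset f \<beta>)"
proof (induction \<beta>)
  case empty
  show ?case by simp
next
  case (add x \<beta>)
  have "(\<Sum>m\<in>insert x (set_mset \<beta>). real (count (add_mset x \<beta>) m) * f m)
      = (\<Sum>m\<in>insert x (set_mset \<beta>). real (count \<beta> m) * f m + (if m = x then f m else 0))"
    by (intro sum.cong) (auto simp: algebra_simps)
  also have "\<dots> = (\<Sum>m\<in>insert x (set_mset \<beta>). real (count \<beta> m) * f m) + f x"
    by (simp add: sum.distrib)
  also have "(\<Sum>m\<in>insert x (set_mset \<beta>). real (count \<beta> m) * f m) = (\<Sum>m\<in>set_mset \<beta>. real (count \<beta> m) * f m)"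
    by (cases "x \<in># \<beta>") (auto simp: insert_absorb not_in_iff)
  finally show ?case using add.IH by simp
qed

text \<open>Write b for the size and M for the sum of \<beta>. A fraction (count of m)/b of the
  arrangements starts with m, and the average of (M - m)/(b - 1) with these weights is again M/b.
  For b = 1 the mean on the left is 0/0, read as 0, so Y has to vanish.\<close>

lemma sum_permutations_remove1:
  fixes X Y :: real and \<beta> :: "nat multiset"
  assumes "\<beta> \<noteq> {#}" "size \<beta> = 1 \<Longrightarrow> Y = 0"
  shows "(\<Sum>m\<in>set_mset \<beta>. real (card (permutations_of_multiset (\<beta> - {#m#}))) *
            (X - real (\<Sum>\<^sub># (\<beta> - {#m#})) / real (size (\<beta> - {#m#})) * Y))
         = real (card (permutations_of_multiset \<beta>)) * (X - real (\<Sum>\<^sub># \<beta>) / real (size \<beta>) * Y)"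
proof -
  define b M p where "b = real (size \<beta>)" and "M = real (\<Sum>\<^sub># \<beta>)" and "p = real (card (permutations_of_multiset \<beta>))"
  have b0: "b > 0" unfolding b_def using assms(1) by (simp add: nonempty_has_size)
  have c0: "(\<Sum>m\<in>set_mset \<beta>. real (count \<beta> m)) = b"
    using sum_count_mult[of \<beta> "\<lambda>_. 1"] unfolding b_def by simp
  have "\<Sum>\<^sub># (image_mset real \<beta>) = M" unfolding M_def by (induction \<beta>) auto
  then have c1: "(\<Sum>m\<in>set_mset \<beta>. real (count \<beta> m) * real m) = M"
    using sum_count_mult[of \<beta> real] by simp
  have term1: "real (card (permutations_of_multiset (\<beta> - {#m#}))) = p / b * real (count \<beta> m)"
    and term2: "real (\<Sum>\<^sub># (\<beta> - {#m#})) = M - real m" and term3: "real (size (\<beta> - {#m#})) = b - 1"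
    if m: "m \<in># \<beta>" for m
  proof -
    show "real (card (permutations_of_multiset (\<beta> - {#m#}))) = p / b * real (count \<beta> m)"
      unfolding p_def b_def using real_card_permutations_of_multiset_remove[OF m] by simp
    obtain \<gamma> where g: "\<beta> = add_mset m \<gamma>" using multi_member_split[OF m] by blast
    show "real (\<Sum>\<^sub># (\<beta> - {#m#})) = M - real m" "real (size (\<beta> - {#m#})) = b - 1"
      unfolding M_def b_def g by auto
  qed
  have "(\<Sum>m\<in>set_mset \<beta>. real (card (permutations_of_multiset (\<beta> - {#m#}))) *
            (X - real (\<Sum>\<^sub># (\<beta> - {#m#})) / real (size (\<beta> - {#m#})) * Y))
      = (\<Sum>m\<in>set_mset \<beta>. p / b * real (count \<beta> m) * (X - (M - real m) / (b - 1) * Y))"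
    by (intro sum.cong refl) (simp only: term1 term2 term3)
  also have "\<dots> = (\<Sum>m\<in>set_mset \<beta>. (p / b * (X - M / (b - 1) * Y)) * real (count \<beta> m)
       + (p / b * Y / (b - 1)) * (real (count \<beta> m) * real m))"
    by (intro sum.cong refl) (simp add: divide_inverse algebra_simps)
  also have "\<dots> = (p / b * (X - M / (b - 1) * Y)) * b + (p / b * Y / (b - 1)) * M"
    unfolding sum.distrib sum_distrib_left[symmetric] c0 c1 ..
  also have "\<dots> = p * (X - M / b * Y)"
  proof (cases "b = 1")
    case True
    then have "Y = 0" using assms(2) unfolding b_def by simp
    then show ?thesis using b0 by simp
  next
    case False
    then show ?thesis using b0 by (simp add: divide_simps) (simp add: algebra_simps)
  qed
  finally show ?thesis unfolding p_def M_def b_def .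
qed

lemma choose_absorb_real:
  "real (Suc n choose k) * (real k / real (Suc n)) = (if k = 0 then 0 else real (n choose (k - 1)))"
proof (cases k)
  case (Suc k')
  have "real (Suc k' * (Suc n choose Suc k')) = real (Suc n * (n choose k'))"
    by (metis Suc_times_binomial_eq mult.commute)
  then have "real (Suc k') * real (Suc n choose Suc k') = real (Suc n) * real (n choose k')"
    unfolding of_nat_mult .
  then show ?thesis unfolding Suc by (simp add: field_simps del: of_nat_Suc binomial_Suc_Suc)
qed simp

text \<open>By absorption, q/N times a binomial of row N is a binomial of row N - 1. The identity
  therefore combines two Pascal rules: the ordinary one with weight Q, and the one a row above for
  the fractions.\<close>

lemma choose_weighted_pascal:
  assumes "0 < N" "0 < q"
  shows "real (Suc N choose q) * (real q / real (Suc N) + Q)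
    = real (N choose q) * (real q / real N + Q) + real (N choose (q - 1)) * (real (q - 1) / real N + Q)"
proof -
  obtain n p where np: "N = Suc n" "q = Suc p" using assms by (metis gr0_implies_Suc)
  have "real (Suc N choose q) * (real q / real (Suc N)) = real (N choose p)"
    unfolding choose_absorb_real np by simp
  moreover have "real (N choose q) * (real q / real N) = real (n choose p)"
    unfolding np choose_absorb_real by simp
  moreover have "real (N choose (q - 1)) * (real (q - 1) / real N) = (if p = 0 then 0 else real (n choose (p - 1)))"
    unfolding np choose_absorb_real by simp
  moreover have "real (N choose p) = real (n choose p) + (if p = 0 then 0 else real (n choose (p - 1)))"
    unfolding np by (cases p) auto
  moreover have "real (Suc N choose q) = real (N choose q) + real (N choose (q - 1))"
    unfolding np(2) by simp
  ultimately show ?thesis by (simp add: distrib_left distrib_right)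
qed

text \<open>The solution for linked chains with parameter \<open>J\<close> on \<open>N + 1\<close> points: think of \<open>s i\<close> brackets of colour
  \<open>i\<close> placed on distinct positions, where position \<open>N + 1\<close> is available only to colours below \<open>J\<close>.
  The quantity \<open>slot_density\<close> is the correction that becomes the ballot term for \<open>J = l\<close>.\<close>

definition slots :: "nat \<Rightarrow> nat \<Rightarrow> nat \<Rightarrow> nat" where
  "slots N J i = (if i < J then Suc N else N)"

definition slot_choices :: "nat \<Rightarrow> nat \<Rightarrow> nat \<Rightarrow> (nat \<Rightarrow> nat) \<Rightarrow> real" where
  "slot_choices N l J s = (\<Prod>i<l. real (slots N J i choose s i))"

definition slot_density :: "nat \<Rightarrow> nat \<Rightarrow> nat \<Rightarrow> (nat \<Rightarrow> nat) \<Rightarrow> real" where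
  "slot_density N l J s = (\<Sum>i<l. real (s i) / real (slots N J i))"

text \<open>Raising J by one opens position N + 1 to colour J only; the two terms tell whether a
  bracket of that colour is put there. Since the second quantity obeys the same additive rule, so
  does every linear combination of the two.\<close>

lemma slot_recursion:
  assumes "0 < N" "J < l" "0 < s J"
  shows "slot_choices N l (Suc J) s = slot_choices N l J s + slot_choices N l J (s(J := s J - 1))"
    and "slot_choices N l (Suc J) s * slot_density N l (Suc J) s = slot_choices N l J s * slot_density N l J s
       + slot_choices N l J (s(J := s J - 1)) * slot_density N l J (s(J := s J - 1))"
proof -
  define P where "P = (\<Prod>i\<in>{..<l} - {J}. real (slots N J i choose s i))"
  define Q where "Q = (\<Sum>i\<in>{..<l} - {J}. real (s i) / real (slots N J i))"
  have rp: "(\<Prod>i<l. f i) = f J * (\<Prod>i\<in>{..<l} - {J}. f i)" for f :: "nat \<Rightarrow> real"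
    using assms(2) by (intro prod.remove) auto
  have rs: "(\<Sum>i<l. f i) = f J + (\<Sum>i\<in>{..<l} - {J}. f i)" for f :: "nat \<Rightarrow> real"
    using assms(2) by (intro sum.remove) auto
  have sl: "slots N (Suc J) i = slots N J i" if "i \<noteq> J" for i
    using that unfolding slots_def by auto
  have P1: "(\<Prod>i\<in>{..<l} - {J}. real (slots N (Suc J) i choose s i)) = P"
    "(\<Prod>i\<in>{..<l} - {J}. real (slots N J i choose (s(J := s J - 1)) i)) = P"
    unfolding P_def by (auto intro!: prod.cong simp: sl)
  have Q1: "(\<Sum>i\<in>{..<l} - {J}. real (s i) / real (slots N (Suc J) i)) = Q"
    "(\<Sum>i\<in>{..<l} - {J}. real ((s(J := s J - 1)) i) / real (slots N J i)) = Q"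
    unfolding Q_def by (auto intro!: sum.cong simp: sl)
  have X: "slot_choices N l (Suc J) s = real (Suc N choose s J) * P"
    "slot_choices N l J s = real (N choose s J) * P"
    "slot_choices N l J (s(J := s J - 1)) = real (N choose (s J - 1)) * P"
    unfolding slot_choices_def rp P1 P_def[symmetric] by (simp_all add: slots_def)
  have W: "slot_density N l (Suc J) s = real (s J) / real (Suc N) + Q"
    "slot_density N l J s = real (s J) / real N + Q"
    "slot_density N l J (s(J := s J - 1)) = real (s J - 1) / real N + Q"
    unfolding slot_density_def rs Q1 Q_def[symmetric] by (simp_all add: slots_def)
  obtain p where p: "s J = Suc p" using assms(3) gr0_implies_Suc by blast
  show "slot_choices N l (Suc J) s = slot_choices N l J s + slot_choices N l J (s(J := s J - 1))"
    unfolding X unfolding p by (simp add: algebra_simps)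
  show "slot_choices N l (Suc J) s * slot_density N l (Suc J) s = slot_choices N l J s * slot_density N l J s
       + slot_choices N l J (s(J := s J - 1)) * slot_density N l J (s(J := s J - 1))"
    using choose_weighted_pascal[OF assms(1,3), of Q, THEN arg_cong, of "\<lambda>t. t * P"]
    unfolding X W by (simp only: distrib_left distrib_right mult_ac)
qed

lemma slot_recursion_0:
  assumes "s J = 0"
  shows "slot_choices N l (Suc J) s = slot_choices N l J s"
    and "slot_density N l (Suc J) s = slot_density N l J s"
proof -
  have "real (slots N (Suc J) i choose s i) = real (slots N J i choose s i)"
    "real (s i) / real (slots N (Suc J) i) = real (s i) / real (slots N J i)" for i
    using assms by (cases "i = J"; auto simp: slots_def)+
  then show "slot_choices N l (Suc J) s = slot_choices N l J s"
    and "slot_density N l (Suc J) s = slot_density N l J s"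
    unfolding slot_choices_def slot_density_def by (simp_all only:)
qed

section \<open>Chains with 1 in the marked block\<close>

lemma nc_1: "nc 1 P \<longleftrightarrow> P = {{1}}"
proof
  assume h: "nc 1 P"
  have "B = {1}" if "B \<in> P" for B
    using nc_subset[OF h that] nc_nonempty[OF h that] by auto
  moreover have "block P 1 \<in> P" using block_mem[OF h, of 1] by simp
  ultimately show "P = {{1}}" by auto
next
  assume "P = {{1}}"
  then show "nc 1 P" unfolding nc_def noncrossing_def partition_on_def disjoint_def by auto
qed

lemma card_typed_chains_1:
  assumes "\<And>i. i < l \<Longrightarrow> s i = 0" "0 < l"
  shows "card (typed_chains 1 l 1 {#} s) = 1"
proof -
  have "typed_chains 1 l 1 {#} s = {replicate l {{1}}}"
  proof (intro equalityI subsetI)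
    fix cs assume "cs \<in> typed_chains 1 l 1 {#} s"
    then have "length cs = l" "\<And>j. j < l \<Longrightarrow> cs ! j = {{1}}"
      unfolding typed_chains_def nc_chains_def nc_1 by auto
    then have "cs = replicate l {{1}}" by (intro nth_equalityI) auto
    then show "cs \<in> {replicate l {{1}}}" by simp
  next
    fix cs :: "nat set set list" assume "cs \<in> {replicate l {{1}}}"
    then have cs: "cs = replicate l {{1}}" by simp
    have "{B \<in> {{1::nat}}. 1 \<notin> B} = {}" by auto
    then have "outer_sizes 1 {{1}} = {#}"
      unfolding outer_sizes_def by (simp only: mset_set.empty image_mset_empty)
    then show "cs \<in> typed_chains 1 l 1 {#} s"
      unfolding typed_chains_def nc_chains_def nc_1 cs
      using assms refines_refl by auto
  qed
  then show ?thesis by simp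
qed

text \<open>No room is left for the block of 1. The ballot factor vanishes in this case, which the
  induction on N meets when the sizes add up to exactly the number of points.\<close>

lemma typed_chains_empty:
  assumes "0 < l" "1 \<le> N" "\<Sum>\<^sub># \<beta> = N"
  shows "typed_chains N l 1 \<beta> s = {}"
proof (rule ccontr)
  assume "typed_chains N l 1 \<beta> s \<noteq> {}"
  then obtain cs where cs: "nc N (cs ! 0)" "outer_sizes 1 (cs ! 0) = \<beta>"
    using assms(1) unfolding typed_chains_def nc_chains_def by auto
  have b: "block (cs ! 0) 1 \<in> cs ! 0" "1 \<in> block (cs ! 0) 1"
    using block_mem[OF cs(1), of 1] assms(2) by auto
  have "card (block (cs ! 0) 1) = 0" using outer_sizes_sum[OF cs(1), of 1] cs(2) assms(2,3) by simp
  then show False using b nc_finite_block[OF cs(1) b(1)] by auto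
qed

text \<open>The outer induction is on N, the inner one on the threshold J. At J = 0 deleting the
  largest element leads back to the outer hypothesis, at J = l the claim for N + 1 is
  reached.\<close>

lemma real_card_typed_chains:
  assumes "0 < l" "1 \<le> N" "0 \<notin># \<beta>" "\<Sum>\<^sub># \<beta> \<le> N" "(\<Sum>i<l. s i) = size \<beta>"
  shows "real (card (typed_chains N l 1 \<beta> s)) = real (card (permutations_of_multiset \<beta>)) *
     ((1 - real (\<Sum>\<^sub># \<beta>) / real N) * (\<Prod>i<l. real (N choose s i)))"
  using assms(2-5)
proof (induction N arbitrary: \<beta> s rule: nat_induct_at_least)
  case base
  show ?case
  proof (cases "\<Sum>\<^sub># \<beta> = 1")
    case True
    then show ?thesis using typed_chains_empty[OF assms(1) _ True] by simp
  next
    case False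
    then have "\<Sum>\<^sub># \<beta> = 0" using base(2) by linarith
    then have b: "\<beta> = {#}" using base(1) by (cases \<beta>) auto
    then have s: "\<And>i. i < l \<Longrightarrow> s i = 0" using base by simp
    show ?thesis using card_typed_chains_1[OF s assms(1)] b s by simp
  qed
next
  case (Suc n)
  show ?case
  proof (cases "\<Sum>\<^sub># \<beta> = Suc n")
    case True
    then show ?thesis using typed_chains_empty[OF assms(1) _ True] by simp
  next
    case False
    then have le: "\<Sum>\<^sub># \<beta> \<le> n" using Suc.prems by simp
    \<comment> \<open>The density equals (size of \<beta>)/n at J = 0 and (size of \<beta>)/(n + 1)
      at J = l, so this formula moves from the ballot factor for n to the one for n + 1. For empty
      \<beta> the mean is 0/0, read as 0, as it should be.\<close>
    have "real (card (linked_chains (Suc n) l J \<beta> s)) = real (card (permutations_of_multiset \<beta>)) *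
       (slot_choices n l J s - real (\<Sum>\<^sub># \<beta>) / real (size \<beta>) * (slot_choices n l J s * slot_density n l J s))"
      if "J \<le> l" "0 \<notin># \<beta>" "\<Sum>\<^sub># \<beta> \<le> n" "(\<Sum>i<l. s i) = size \<beta>" for J \<beta> s
      using that
    proof (induction J arbitrary: \<beta> s)
      case 0
      have d: "slot_density n l 0 s = real (size \<beta>) / real n"
        unfolding slot_density_def slots_def using 0(4) by (simp add: sum_divide_distrib[symmetric] of_nat_sum[symmetric] del: of_nat_sum)
      have c: "slot_choices n l 0 s = (\<Prod>i<l. real (n choose s i))"
        unfolding slot_choices_def slots_def by simp
      have "real (card (linked_chains (Suc n) l 0 \<beta> s)) = real (card (typed_chains n l 1 \<beta> s))"
        using card_linked_chains_0[OF Suc.hyps assms(1)] linked_chains_full by simp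
      also have "\<dots> = real (card (permutations_of_multiset \<beta>)) *
          ((1 - real (\<Sum>\<^sub># \<beta>) / real n) * slot_choices n l 0 s)"
        unfolding c using Suc.IH[OF 0(2-4)] .
      also have "(1 - real (\<Sum>\<^sub># \<beta>) / real n) * slot_choices n l 0 s =
          slot_choices n l 0 s - real (\<Sum>\<^sub># \<beta>) / real (size \<beta>) * (slot_choices n l 0 s * slot_density n l 0 s)"
        unfolding d by (cases "\<beta> = {#}") (simp_all add: algebra_simps)
      finally show ?case .
    next
      case (Suc J)
      have J: "J < l" "J \<le> l" using Suc.prems(1) by auto
      have IH: "real (card (linked_chains (Suc n) l J \<beta> s)) = real (card (permutations_of_multiset \<beta>)) *
       (slot_choices n l J s - real (\<Sum>\<^sub># \<beta>) / real (size \<beta>) * (slot_choices n l J s * slot_density n l J s))"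
        by (rule Suc.IH[OF J(2) Suc.prems(2-4)])
      have lt: "\<Sum>\<^sub># \<beta> < Suc n" using Suc.prems(3) by simp
      note rec = card_linked_chains_Suc[of "Suc n", OF _ J(1) Suc.prems(2) lt, of s]
      show ?case
      proof (cases "s J = 0")
        case True
        then show ?thesis using rec IH slot_recursion_0[of s J n l] by simp
      next
        case False
        define s' where "s' = s(J := s J - 1)"
        define X' Y' where "X' = slot_choices n l J s'" and "Y' = slot_choices n l J s' * slot_density n l J s'"
        have sum: "(\<Sum>i<l. f i) = f J + (\<Sum>i\<in>{..<l} - {J}. f i)" for f :: "nat \<Rightarrow> nat"
          using J(1) by (intro sum.remove) auto
        have ss: "(\<Sum>i<l. s' i) = size \<beta> - 1"
          using Suc.prems(4) False unfolding sum s'_def by simp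
        have ne: "\<beta> \<noteq> {#}" using Suc.prems(4) False unfolding sum by auto
        have t: "real (card (linked_chains (Suc n) l J (\<beta> - {#m#}) s')) =
          real (card (permutations_of_multiset (\<beta> - {#m#}))) *
            (X' - real (\<Sum>\<^sub># (\<beta> - {#m#})) / real (size (\<beta> - {#m#})) * Y')" if m: "m \<in># \<beta>" for m
        proof -
          have "0 \<notin># \<beta> - {#m#}" using Suc.prems(2) by (meson in_diffD)
          moreover obtain \<gamma> where g: "\<beta> = add_mset m \<gamma>" using multi_member_split[OF m] by blast
          then have "\<Sum>\<^sub># (\<beta> - {#m#}) \<le> n" using Suc.prems(3) by simp
          moreover have "(\<Sum>i<l. s' i) = size (\<beta> - {#m#})" using ss g by simp
          ultimately show ?thesis unfolding X'_def Y'_def by (rule Suc.IH[OF J(2)])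
        qed
        \<comment> \<open>When the only bracket has been taken away all remaining drops are zero, so
          the density is zero; this is the proviso of the averaging identity.\<close>
        have Y0: "Y' = 0" if "size \<beta> = 1"
        proof -
          have "\<forall>i<l. s' i = 0" using ss that by simp
          then show ?thesis unfolding Y'_def slot_density_def by simp
        qed
        have "real (card (linked_chains (Suc n) l (Suc J) \<beta> s)) = real (card (linked_chains (Suc n) l J \<beta> s))
           + (\<Sum>m\<in>set_mset \<beta>. real (card (linked_chains (Suc n) l J (\<beta> - {#m#}) s')))"
          using rec False unfolding s'_def by simp
        also have "(\<Sum>m\<in>set_mset \<beta>. real (card (linked_chains (Suc n) l J (\<beta> - {#m#}) s')))
          = real (card (permutations_of_multiset \<beta>)) * (X' - real (\<Sum>\<^sub># \<beta>) / real (size \<beta>) * Y')"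
          using sum_permutations_remove1[OF ne Y0, of X'] t by simp
        finally have *: "real (card (linked_chains (Suc n) l (Suc J) \<beta> s)) =
          real (card (permutations_of_multiset \<beta>)) * (slot_choices n l J s -
            real (\<Sum>\<^sub># \<beta>) / real (size \<beta>) * (slot_choices n l J s * slot_density n l J s)) +
          real (card (permutations_of_multiset \<beta>)) * (X' - real (\<Sum>\<^sub># \<beta>) / real (size \<beta>) * Y')"
          unfolding IH .
        have n: "0 < n" and sJ: "0 < s J" using Suc.hyps False \<open>1 \<le> n\<close> by auto
        have alg: "p * (x - c * y) + p * (x' - c * y') = p * ((x + x') - c * (y + y'))" for p x y x' y' c :: real
          by (simp add: algebra_simps)
        show ?thesis
          unfolding * alg slot_recursion(2)[where s = s, OF n J(1) sJ] X'_def Y'_def s'_def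
          unfolding slot_recursion(1)[where s = s, OF n J(1) sJ] ..
      qed
    qed
    from this[OF order_refl Suc.prems(1) le Suc.prems(3)]
    have "real (card (typed_chains (Suc n) l 1 \<beta> s)) = real (card (permutations_of_multiset \<beta>)) *
       (slot_choices n l l s - real (\<Sum>\<^sub># \<beta>) / real (size \<beta>) * (slot_choices n l l s * slot_density n l l s))"
      unfolding linked_chains_full .
    moreover have "slot_density n l l s = real (size \<beta>) / real (Suc n)"
      unfolding slot_density_def slots_def Suc.prems(3)[symmetric] by (simp add: sum_divide_distrib)
    moreover have "slot_choices n l l s = (\<Prod>i<l. real (Suc n choose s i))"
      unfolding slot_choices_def slots_def by simp
    ultimately show ?thesis
      by (cases "\<beta> = {#}") (simp_all add: left_diff_distrib)
  qed
qed

section \<open>Rotation and double counting\<close>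

text \<open>The cycle 1, 2, ..., N, 1, continued by the identity outside {1..N} to make it injective
  on all natural numbers.\<close>

definition rot :: "nat \<Rightarrow> nat \<Rightarrow> nat" where
  "rot N x = (if x = N then 1 else if 0 < x \<and> x < N then Suc x else x)"

lemma inj_rot: "1 \<le> N \<Longrightarrow> inj (rot N)"
  unfolding inj_def rot_def by auto

lemma rot_image: "1 \<le> N \<Longrightarrow> rot N ` {1..N} = {1..N}"
  by (intro endo_inj_surj) (auto simp: rot_def intro: inj_on_subset[OF inj_rot])

lemma nc_rot:
  assumes "1 \<le> N" "nc N P"
  shows "nc N ((`) (rot N) ` P)"
proof -
  have "partition_on (rot N ` {1..N}) ((`) (rot N) ` P - {{}})"
    using assms(2) unfolding nc_def
    by (intro partition_on_inj_image) (auto intro: inj_on_subset[OF inj_rot[OF assms(1)]])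
  moreover have "{} \<notin> (`) (rot N) ` P" using nc_nonempty[OF assms(2)] by auto
  ultimately have part: "partition_on {1..N} ((`) (rot N) ` P)" unfolding rot_image[OF assms(1)] by simp
  have "noncrossing ((`) (rot N) ` P)"
    unfolding noncrossing_def
  proof (rule notI, elim exE conjE)
    fix a b c d B D
    assume h: "a < b" "b < c" "c < d" "B \<in> (`) (rot N) ` P" "D \<in> (`) (rot N) ` P" "B \<noteq> D"
      "a \<in> B" "c \<in> B" "b \<in> D" "d \<in> D"
    obtain B' D' where BD: "B' \<in> P" "D' \<in> P" "B = rot N ` B'" "D = rot N ` D'" using h(4,5) by auto
    obtain a' c' b' d' where e: "a' \<in> B'" "c' \<in> B'" "b' \<in> D'" "d' \<in> D'"
      "a = rot N a'" "c = rot N c'" "b = rot N b'" "d = rot N d'"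
      using h(7-10) BD by auto
    have r: "x \<in> {1..N}" if "x \<in> B' \<or> x \<in> D'" for x
      using that nc_subset[OF assms(2)] BD(1,2) by blast
    have in1: "a' \<in> {1..N}" "b' \<in> {1..N}" "c' \<in> {1..N}" "d' \<in> {1..N}" using e r by auto
    have v: "b' = b - 1" "c' = c - 1" "d' = d - 1" "b > 1" "b' < N" "c' < N" "d' < N"
      using e h(1-3) in1 unfolding rot_def by (auto split: if_splits)
    show False
    proof (cases "a' = N")
      \<comment> \<open>Only a can be the image of N. Undoing the rotation moves it from first to
        last place, and b' < c' < d' < a' alternates again, with the two blocks exchanged.\<close>
      case True
      then show ?thesis using nc_crossD[OF assms(2) BD(2,1) e(3,4,2,1)] v h BD by auto
    next
      case False
      then have "a = Suc a'" using e(5) in1 unfolding rot_def by auto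
      then show ?thesis using nc_crossD[OF assms(2) BD(1,2) e(1-4)] v h BD by auto
    qed
  qed
  with part show ?thesis unfolding nc_def by simp
qed

lemma outer_sizes_rot:
  assumes "1 \<le> N"
  shows "outer_sizes (rot N y) ((`) (rot N) ` P) = outer_sizes y P"
proof -
  note inj = inj_rot[OF assms]
  have "{B \<in> (`) (rot N) ` P. rot N y \<notin> B} = (`) (rot N) ` {B \<in> P. y \<notin> B}"
    using inj_image_mem_iff[OF inj] by auto
  moreover have "mset_set ((`) (rot N) ` Q) = image_mset ((`) (rot N)) (mset_set Q)" for Q
    by (rule image_mset_mset_set[symmetric]) (use inj in \<open>auto intro!: inj_onI simp: inj_image_eq_iff\<close>)
  moreover have "card (rot N ` B) = card B" for B
    using inj by (intro card_image) (auto intro: inj_on_subset)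
  ultimately show ?thesis unfolding outer_sizes_def by (simp add: image_mset.compositionality o_def)
qed

lemma card_typed_chains_rot_le:
  assumes "1 \<le> N" "0 < l"
  shows "card (typed_chains N l y \<beta> s) \<le> card (typed_chains N l (rot N y) \<beta> s)"
proof (rule card_inj_on_le)
  have inj: "inj ((`) ((`) (rot N)))" using inj_rot[OF assms(1)] by (metis injI inj_image_eq_iff)
  then show "inj_on (map ((`) ((`) (rot N)))) (typed_chains N l y \<beta> s)"
    by (meson inj_mapI inj_on_subset subset_UNIV)
  show "map ((`) ((`) (rot N))) ` typed_chains N l y \<beta> s \<subseteq> typed_chains N l (rot N y) \<beta> s"
  proof
    fix ds assume "ds \<in> map ((`) ((`) (rot N))) ` typed_chains N l y \<beta> s"
    then obtain cs where ds: "ds = map ((`) ((`) (rot N))) cs" and cs: "cs \<in> typed_chains N l y \<beta> s" by blast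
    have "inj ((`) (rot N))" using inj_rot[OF assms(1)] by (metis injI inj_image_eq_iff)
    then have c: "card ((`) (rot N) ` P) = card P" for P
      by (intro card_image) (auto intro: inj_on_subset)
    have r: "refines ((`) (rot N) ` P) ((`) (rot N) ` Q)" if PQ: "refines P Q" for P Q
      unfolding refines_def
    proof
      fix B assume "B \<in> (`) (rot N) ` P"
      then obtain B' where B': "B' \<in> P" "B = rot N ` B'" by blast
      then obtain C where "C \<in> Q" "B' \<subseteq> C" using PQ unfolding refines_def by blast
      then have "rot N ` C \<in> (`) (rot N) ` Q" "B \<subseteq> rot N ` C" using B' by auto
      then show "\<exists>C\<in>(`) (rot N) ` Q. B \<subseteq> C" by blast
    qed
    show "ds \<in> typed_chains N l (rot N y) \<beta> s"
      using cs assms(2) nc_rot[OF assms(1)] outer_sizes_rot[OF assms(1)] c r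
      unfolding ds typed_chains_def nc_chains_def by auto
  qed
qed (rule finite_typed_chains)

text \<open>The one-sided inequalities run around the cycle from 1 to N and back to 1, so they close
  up to equalities; this takes the place of an inverse rotation.\<close>

lemma card_typed_chains_eq:
  assumes "y \<in> {1..N}" "0 < l"
  shows "card (typed_chains N l y \<beta> s) = card (typed_chains N l 1 \<beta> s)"
proof -
  define f where "f y = card (typed_chains N l y \<beta> s)" for y
  have N: "1 \<le> N" using assms by auto
  have st: "f y \<le> f (rot N y)" for y unfolding f_def by (rule card_typed_chains_rot_le[OF N assms(2)])
  have up: "f i \<le> f j" if "1 \<le> i" "i \<le> j" "j \<le> N" for i j
    using that(2,3)
  proof (induction j rule: dec_induct)
    case (step m)
    then have "f i \<le> f m" by simp
    also have "f m \<le> f (Suc m)" using st[of m] step that(1) unfolding rot_def by auto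
    finally show ?case .
  qed simp
  have "f N \<le> f 1" using st[of N] unfolding rot_def by simp
  then have "f y = f 1" using up[of 1 y] up[of y N] assms by force
  then show ?thesis unfolding f_def .
qed

section \<open>Counting marked points\<close>

definition marked_chains ::
  "nat \<Rightarrow> nat \<Rightarrow> nat multiset \<Rightarrow> (nat \<Rightarrow> nat) \<Rightarrow> nat set set list set" where
  "marked_chains N l \<beta> s = (\<Union>y\<in>{1..N}. typed_chains N l y \<beta> s)"

text \<open>The last hypothesis makes the marked block the only one of its size. If z realised
  \<beta> from outside the block of y, the block of z would have the marked size and also be counted
  in \<beta>.\<close>

lemma marked_positions:
  assumes "nc N P" "y \<in> {1..N}" "outer_sizes y P = \<beta>" "N - \<Sum>\<^sub># \<beta> \<notin># \<beta>"
  shows "{z \<in> {1..N}. outer_sizes z P = \<beta>} = block P y"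
proof (intro equalityI subsetI)
  fix z assume z: "z \<in> block P y"
  have zN: "z \<in> {1..N}" using nc_subset[OF assms(1)] block_mem(1)[OF assms(1,2)] z by blast
  have "z \<in> B \<longleftrightarrow> y \<in> B" if "B \<in> P" for B
    using nc_disj[OF assms(1) that block_mem(1)[OF assms(1,2)]] z block_mem(2)[OF assms(1,2)] by blast
  then have "{B \<in> P. z \<notin> B} = {B \<in> P. y \<notin> B}" by blast
  then show "z \<in> {z \<in> {1..N}. outer_sizes z P = \<beta>}" using assms(3) zN unfolding outer_sizes_def by simp
next
  fix z assume "z \<in> {z \<in> {1..N}. outer_sizes z P = \<beta>}"
  then have z: "z \<in> {1..N}" "outer_sizes z P = \<beta>" by auto
  have c: "card (block P z) = N - \<Sum>\<^sub># \<beta>" using outer_sizes_sum[OF assms(1) z(1)] z(2) by simp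
  have "y \<in> block P z"
  proof (rule ccontr)
    assume "y \<notin> block P z"
    then have "block P z \<in> {B \<in> P. y \<notin> B}" using block_mem(1)[OF assms(1) z(1)] by simp
    then have "card (block P z) \<in># outer_sizes y P"
      unfolding outer_sizes_def using nc_finite[OF assms(1)] by auto
    then show False using c assms(3,4) by simp
  qed
  then show "z \<in> block P y" using block_mem_iff[OF assms(1) z(1)] block_mem(2)[OF assms(1) z(1)] by metis
qed

text \<open>Pairs of a chain and a marked point are counted by points and by chains. The number of
  points per chain is N times the ballot factor, so both cancel.\<close>

lemma card_marked_chains:
  assumes "0 < l" "0 \<notin># \<beta>" "\<Sum>\<^sub># \<beta> < N" "(\<Sum>i<l. s i) = size \<beta>" "N - \<Sum>\<^sub># \<beta> \<notin># \<beta>"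
  shows "card (marked_chains N l \<beta> s) = card (permutations_of_multiset \<beta>) * (\<Prod>i<l. N choose s i)"
proof -
  define T where "T = marked_chains N l \<beta> s"
  have N: "1 \<le> N" using assms(3) by simp
  have fin: "finite T" unfolding T_def marked_chains_def using finite_typed_chains by auto
  have sub: "typed_chains N l y \<beta> s = {cs \<in> T. outer_sizes y (cs ! 0) = \<beta>}" if "y \<in> {1..N}" for y
    using that unfolding T_def marked_chains_def typed_chains_def by auto
  have "(\<Sum>y\<in>{1..N}. card {cs \<in> T. outer_sizes y (cs ! 0) = \<beta>}) = (N - \<Sum>\<^sub># \<beta>) * card T"
  proof (rule sum_multicount)
    show "\<forall>cs\<in>T. card {y \<in> {1..N}. outer_sizes y (cs ! 0) = \<beta>} = N - \<Sum>\<^sub># \<beta>"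
    proof
      fix cs assume "cs \<in> T"
      then obtain y where y: "y \<in> {1..N}" "cs \<in> typed_chains N l y \<beta> s" unfolding T_def marked_chains_def by blast
      then have nc: "nc N (cs ! 0)" "outer_sizes y (cs ! 0) = \<beta>"
        using assms(1) unfolding typed_chains_def nc_chains_def by auto
      show "card {y \<in> {1..N}. outer_sizes y (cs ! 0) = \<beta>} = N - \<Sum>\<^sub># \<beta>"
        unfolding marked_positions[OF nc(1) y(1) nc(2) assms(5)]
        using outer_sizes_sum[OF nc(1) y(1)] nc(2) by simp
    qed
  qed (use fin in auto)
  moreover have "(\<Sum>y\<in>{1..N}. card {cs \<in> T. outer_sizes y (cs ! 0) = \<beta>}) = N * card (typed_chains N l 1 \<beta> s)"
  proof -
    have "card {cs \<in> T. outer_sizes y (cs ! 0) = \<beta>} = card (typed_chains N l 1 \<beta> s)" if "y \<in> {1..N}" for y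
      using card_typed_chains_eq[OF that assms(1), of \<beta> s] unfolding sub[OF that] .
    then show ?thesis by simp
  qed
  ultimately have "real N * real (card (typed_chains N l 1 \<beta> s)) = real (N - \<Sum>\<^sub># \<beta>) * real (card T)"
    by (metis of_nat_mult)
  moreover have "real N * (1 - real (\<Sum>\<^sub># \<beta>) / real N) = real (N - \<Sum>\<^sub># \<beta>)"
    using assms(3) N by (simp add: field_simps)
  ultimately have "real (N - \<Sum>\<^sub># \<beta>) * real (card T) = real (N - \<Sum>\<^sub># \<beta>) *
      (real (card (permutations_of_multiset \<beta>)) * (\<Prod>i<l. real (N choose s i)))"
    using real_card_typed_chains[OF assms(1) N assms(2) less_imp_le[OF assms(3)] assms(4)]
    by (metis (no_types, lifting) mult.assoc mult.left_commute)
  moreover have "real (N - \<Sum>\<^sub># \<beta>) \<noteq> 0" using assms(3) by (simp del: of_nat_diff)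
  ultimately have "real (card T) = real (card (permutations_of_multiset \<beta>)) * (\<Prod>i<l. real (N choose s i))"
    by (rule mult_left_cancel[THEN iffD1, rotated])
  then have "real (card T) = real (card (permutations_of_multiset \<beta>) * (\<Prod>i<l. N choose s i))" by simp
  then show ?thesis unfolding T_def of_nat_eq_iff .
qed

section \<open>Translation from the k-divisible setting\<close>

lemma dvd_mset_sum:
  fixes A :: "nat multiset"
  shows "\<forall>m\<in>#A. k dvd m \<Longrightarrow> k dvd \<Sum>\<^sub># A"
  by (induction A) auto

text \<open>A block of Q other than the one around the exceptional block B0 is a union of blocks of
  P whose sizes k divides.\<close>

lemma NCk_refines:
  assumes "NCk k n r P" "nc (k * n + r) Q" "refines P Q"
  shows "NCk k n r Q"
proof -
  have nP: "nc (k * n + r) P" using assms(1) unfolding NCk_def nc_def by simp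
  obtain B0 where B0: "B0 \<in> P" "\<And>B. B \<in> P \<Longrightarrow> B \<noteq> B0 \<Longrightarrow> k dvd card B"
    using assms(1) unfolding NCk_def by blast
  obtain C0 where C0: "C0 \<in> Q" "B0 \<subseteq> C0" using assms(3) B0(1) unfolding refines_def by blast
  have "k dvd card C" if C: "C \<in> Q" "C \<noteq> C0" for C
  proof -
    define R where "R = {B \<in> P. B \<subseteq> C}"
    have "B0 \<notin> R" using nc_disj[OF assms(2) C(1) C0(1)] C(2) C0(2) nc_nonempty[OF nP B0(1)]
      unfolding R_def by blast
    have "C \<subseteq> \<Union>R"
    proof
      fix x assume x: "x \<in> C"
      then have xN: "x \<in> {1..k * n + r}" using nc_subset[OF assms(2) C(1)] by blast
      have "block P x \<subseteq> C" using refines_block[OF nP assms(2,3) xN] block_eq[OF assms(2) C(1) x] by simp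
      then show "x \<in> \<Union>R" using block_mem[OF nP xN] unfolding R_def by blast
    qed
    then have "C = \<Union>R" unfolding R_def by blast
    also have "card \<dots> = (\<Sum>B\<in>R. card B)"
      using nP nc_finite_block[OF nP] unfolding R_def nc_def partition_on_def disjoint_def
      by (intro card_Union_disjoint) (auto simp: pairwise_def disjnt_def)
    also have "k dvd \<dots>" using B0(2) \<open>B0 \<notin> R\<close> unfolding R_def by (intro dvd_sum) auto
    finally show ?thesis .
  qed
  then show ?thesis using C0(1) assms(2) unfolding NCk_def nc_def by blast
qed

context
  fixes k n r :: nat
  assumes r: "0 < r" "r < k"
begin

lemma not_dvd_total: "\<not> k dvd k * n + r"
  using r by (simp add: dvd_add_right_iff nat_dvd_not_less)

lemma NCk_iff:
  "NCk k n r P \<longleftrightarrow> nc (k * n + r) P \<and> (\<exists>y\<in>{1..k*n+r}. \<forall>m\<in>#outer_sizes y P. k dvd m)"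
proof
  assume P: "NCk k n r P"
  then have nP: "nc (k * n + r) P" unfolding NCk_def nc_def by simp
  obtain B0 where B0: "B0 \<in> P" "\<And>B. B \<in> P \<Longrightarrow> B \<noteq> B0 \<Longrightarrow> k dvd card B"
    using P unfolding NCk_def by blast
  obtain y where y: "y \<in> B0" using nc_nonempty[OF nP B0(1)] by blast
  then have "y \<in> {1..k*n+r}" using nc_subset[OF nP B0(1)] by blast
  moreover have "\<forall>m\<in>#outer_sizes y P. k dvd m"
    unfolding outer_sizes_def using nc_finite[OF nP] B0(2) y by auto
  ultimately show "nc (k * n + r) P \<and> (\<exists>y\<in>{1..k*n+r}. \<forall>m\<in>#outer_sizes y P. k dvd m)"
    using nP by blast
next
  assume "nc (k * n + r) P \<and> (\<exists>y\<in>{1..k*n+r}. \<forall>m\<in>#outer_sizes y P. k dvd m)"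
  then obtain y where nP: "nc (k * n + r) P" and y: "y \<in> {1..k*n+r}" "\<And>m. m \<in># outer_sizes y P \<Longrightarrow> k dvd m"
    by blast
  have "k dvd card B" if "B \<in> P" "B \<noteq> block P y" for B
  proof (rule y(2))
    have "y \<notin> B" using block_eq[OF nP that(1)] that(2) by blast
    then show "card B \<in># outer_sizes y P" unfolding outer_sizes_def using nc_finite[OF nP] that(1) by auto
  qed
  then show "NCk k n r P"
    using nP block_mem(1)[OF nP y(1)] unfolding NCk_def nc_def by blast
qed

text \<open>Since k does not divide kn + r, the exceptional block really escapes the count. The rank
  is therefore n + 1 minus the number of blocks.\<close>

lemma card_eq_bkprime:
  assumes "NCk k n r P"
  shows "card P = Suc (bkprime k P)"
proof -
  have nP: "nc (k * n + r) P" using assms unfolding NCk_def nc_def by simp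
  obtain B0 where B0: "B0 \<in> P" "\<And>B. B \<in> P \<Longrightarrow> B \<noteq> B0 \<Longrightarrow> k dvd card B"
    using assms unfolding NCk_def by blast
  have "\<not> k dvd card B0"
  proof
    assume "k dvd card B0"
    then have "k dvd (\<Sum>B\<in>P. card B)" using B0(2) by (intro dvd_sum) blast
    also have "(\<Sum>B\<in>P. card B) = card (\<Union>P)"
      using nP nc_finite_block[OF nP] unfolding nc_def partition_on_def disjoint_def
      by (intro card_Union_disjoint[symmetric]) (auto simp: pairwise_def disjnt_def)
    also have "\<dots> = k * n + r" using nP unfolding nc_def partition_on_def by simp
    finally show False using not_dvd_total by simp
  qed
  then have "P = insert B0 {B \<in> P. k dvd card B}" "B0 \<notin> {B \<in> P. k dvd card B}"
    using B0 by auto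
  moreover have "finite {B \<in> P. k dvd card B}" using nc_finite[OF nP] by simp
  ultimately have "card P = Suc (card {B \<in> P. k dvd card B})" by (metis card_insert_disjoint)
  then show ?thesis unfolding bkprime_def .
qed

text \<open>The type sees sizes k * i with 1 \<le> i \<le> n. That covers every unmarked block,
  because sizes are at most kn + r < k(n + 1), and never the marked one, whose size k does not
  divide.\<close>

lemma has_type_iff_outer_sizes:
  assumes "nc (k * n + r) P" "y \<in> {1..k*n+r}" "\<forall>m\<in>#outer_sizes y P. k dvd m" "(\<Sum>i=1..n. bs i) = b"
  shows "has_type k n P b bs \<longleftrightarrow> outer_sizes y P = (\<Sum>i=1..n. replicate_mset (bs i) (k * i))"
proof -
  define \<beta> where "\<beta> = (\<Sum>i=1..n. replicate_mset (bs i) (k * i))"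
  have k: "0 < k" using r by simp
  have fin: "finite P" by (rule nc_finite[OF assms(1)])
  have nd: "\<not> k dvd card (block P y)"
  proof
    assume "k dvd card (block P y)"
    moreover have "k dvd \<Sum>\<^sub># (outer_sizes y P)"
      using assms(3) by (rule dvd_mset_sum)
    ultimately have "k dvd card (block P y) + \<Sum>\<^sub># (outer_sizes y P)" by (rule dvd_add)
    then show False using outer_sizes_sum[OF assms(1,2)] not_dvd_total by simp
  qed
  have cnt: "count (outer_sizes y P) m = card {B \<in> P. y \<notin> B \<and> card B = m}" for m
  proof -
    have "count (outer_sizes y P) m = card (card -` {m} \<inter> {B \<in> P. y \<notin> B})"
      unfolding outer_sizes_def using fin by (simp add: count_image_mset)
    also have "card -` {m} \<inter> {B \<in> P. y \<notin> B} = {B \<in> P. y \<notin> B \<and> card B = m}" by auto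
    finally show ?thesis .
  qed
  have cnt': "count (outer_sizes y P) (k * i) = card {B \<in> P. card B = k * i}" for i
  proof -
    have "y \<notin> B" if "B \<in> P" "card B = k * i" for B
      using block_eq[OF assms(1) that(1)] nd that(2) by auto
    then have "{B \<in> P. y \<notin> B \<and> card B = k * i} = {B \<in> P. card B = k * i}" by blast
    then show ?thesis unfolding cnt by simp
  qed
  have sumc: "count \<beta> m = (\<Sum>i=1..n. if m = k * i then bs i else 0)" for m
    unfolding \<beta>_def count_sum by (intro sum.cong) auto
  have cb: "count \<beta> (k * i) = (if i \<in> {1..n} then bs i else 0)" for i
    unfolding sumc using k by simp
  have cb': "count \<beta> m = 0" if "\<not> k dvd m" for m
    unfolding sumc using that by (intro sum.neutral) auto
  have "outer_sizes y P = \<beta> \<longleftrightarrow> (\<forall>i\<in>{1..n}. card {B \<in> P. card B = k * i} = bs i)"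
  proof
    assume "outer_sizes y P = \<beta>"
    then show "\<forall>i\<in>{1..n}. card {B \<in> P. card B = k * i} = bs i" using cnt' cb by metis
  next
    assume h: "\<forall>i\<in>{1..n}. card {B \<in> P. card B = k * i} = bs i"
    show "outer_sizes y P = \<beta>"
    proof (rule multiset_eqI)
      fix m
      show "count (outer_sizes y P) m = count \<beta> m"
      proof (cases "k dvd m")
        case False
        then have "m \<notin># outer_sizes y P" using assms(3) by blast
        then show ?thesis using cb'[OF False] by (simp add: not_in_iff)
      next
        case True
        then obtain i where i: "m = k * i" by blast
        show ?thesis
        proof (cases "i \<in> {1..n}")
          case True
          then show ?thesis unfolding i cnt' cb using h by simp
        next
          case False
          have "card B \<noteq> k * i" if "B \<in> P" for B
          proof
            assume c: "card B = k * i"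
            have "i \<noteq> 0" using c nc_nonempty[OF assms(1) that] nc_finite_block[OF assms(1) that] by auto
            then have "Suc n \<le> i" using False by simp
            then have "k * Suc n \<le> k * i" by (rule mult_le_mono2)
            moreover have "card B \<le> k * n + r"
              using card_mono[OF _ nc_subset[OF assms(1) that]] by simp
            ultimately show False using c r by simp
          qed
          then have "{B \<in> P. card B = k * i} = {}" by blast
          then show ?thesis unfolding i cnt' cb by (simp only: card.empty False if_False)
        qed
      qed
    qed
  qed
  moreover have "b = (\<Sum>i=1..n. card {B \<in> P. card B = k * i})"
    if "\<forall>i\<in>{1..n}. card {B \<in> P. card B = k * i} = bs i"
    using that assms(4) by simp
  ultimately show ?thesis unfolding has_type_def \<beta>_def by blast
qed

end

section \<open>Rank jumps and the multinomial coefficient\<close>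

lemma tail_sums_iff:
  fixes f t :: "nat \<Rightarrow> nat"
  assumes "0 < l"
  shows "(\<forall>j<l. f j = (\<Sum>i=j..<l. t i)) \<longleftrightarrow>
    f (l - 1) = t (l - 1) \<and> (\<forall>j. Suc j < l \<longrightarrow> f j = t j + f (Suc j))"
proof
  assume h: "\<forall>j<l. f j = (\<Sum>i=j..<l. t i)"
  then show "f (l - 1) = t (l - 1) \<and> (\<forall>j. Suc j < l \<longrightarrow> f j = t j + f (Suc j))"
    using assms by (auto simp: sum.atLeast_Suc_lessThan)
next
  assume h: "f (l - 1) = t (l - 1) \<and> (\<forall>j. Suc j < l \<longrightarrow> f j = t j + f (Suc j))"
  have "f j = (\<Sum>i=j..<l. t i)" if "j \<le> l - 1" for j
    using that
  proof (induction j rule: inc_induct)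
    case base
    then show ?case using h assms by (simp add: sum.atLeast_Suc_lessThan)
  next
    case (step j)
    then have "Suc j < l" by simp
    then show ?case using step h by (simp add: sum.atLeast_Suc_lessThan)
  qed
  then show "\<forall>j<l. f j = (\<Sum>i=j..<l. t i)" by simp
qed

text \<open>The shift by 2 arises because \<open>s 1\<close> is the rank of the first partition
  while levels start at 0. As b \<le> n, the truncated n - b is exact, and the condition on
  \<open>s 1\<close> says that the tail sum from 0 is b.\<close>

lemma rank_jump_iff:
  assumes "0 < l" "length cs = l" "s 1 = n - b" "b \<le> n" "(\<Sum>i=0..<l. s (i + 2)) = b"
  shows "(\<forall>j\<in>{1..l+1}. rank_jump k n cs j = int (s j)) \<longleftrightarrow>
    (\<forall>j<l. bkprime k (cs ! j) = (\<Sum>i=j..<l. s (i + 2)))"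
proof -
  define f where "f j = bkprime k (cs ! j)" for j
  have J1: "rank_jump k n cs 1 = int n - int (f 0)"
    unfolding rank_jump_def nc_rank_def f_def by simp
  have Jl: "rank_jump k n cs (l + 1) = int (f (l - 1))"
    unfolding rank_jump_def nc_rank_def f_def Let_def using assms(1,2) by simp
  have Jm: "rank_jump k n cs (j + 2) = int (f j) - int (f (Suc j))" if "Suc j < l" for j
    unfolding rank_jump_def nc_rank_def f_def Let_def using that assms(2) by simp
  have split: "{1..l+1} = insert 1 (insert (l + 1) ((\<lambda>j. j + 2) ` {j. Suc j < l}))"
  proof (intro equalityI subsetI)
    fix j assume j: "j \<in> {1..l+1}"
    show "j \<in> insert 1 (insert (l + 1) ((\<lambda>j. j + 2) ` {j. Suc j < l}))"
    proof (cases "j = 1 \<or> j = l + 1")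
      case False
      then have "j = (j - 2) + 2" "Suc (j - 2) < l" using j by auto
      then show ?thesis by blast
    qed auto
  qed (use assms(1) in auto)
  have "(\<forall>j\<in>{1..l+1}. rank_jump k n cs j = int (s j)) \<longleftrightarrow>
      int n - int (f 0) = int (s 1) \<and> int (f (l - 1)) = int (s (l + 1)) \<and>
      (\<forall>j. Suc j < l \<longrightarrow> int (f j) - int (f (Suc j)) = int (s (j + 2)))"
    unfolding split using J1 Jl Jm by (simp del: One_nat_def add_2_eq_Suc')
  also have "\<dots> \<longleftrightarrow> f 0 = b \<and> f (l - 1) = s (l - 1 + 2) \<and> (\<forall>j. Suc j < l \<longrightarrow> f j = s (j + 2) + f (Suc j))"
    using assms(1,3,4) by auto
  also have "\<dots> \<longleftrightarrow> f 0 = b \<and> (\<forall>j<l. f j = (\<Sum>i=j..<l. s (i + 2)))"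
    using tail_sums_iff[OF assms(1), of f "\<lambda>i. s (i + 2)"] by simp
  also have "\<dots> \<longleftrightarrow> (\<forall>j<l. f j = (\<Sum>i=j..<l. s (i + 2)))"
    using assms(1,5) by auto
  finally show ?thesis unfolding f_def .
qed

text \<open>For k > 0 distinct i give distinct sizes k * i, so the multiplicities in \<beta> are the
  b_i; indices with b_i = 0 contribute the factor 0! = 1.\<close>

lemma card_permutations_block_sizes:
  assumes "0 < k" "(\<Sum>i=1..n. bs i) = b"
  shows "card (permutations_of_multiset (\<Sum>i=1..n. replicate_mset (bs i) (k * i))) = multinomial b bs n"
proof -
  define \<beta> where "\<beta> = (\<Sum>i=1..n. replicate_mset (bs i) (k * i))"
  have cb: "count \<beta> (k * i) = bs i" if "i \<in> {1..n}" for i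
  proof -
    have "count \<beta> (k * i) = (\<Sum>j=1..n. if j = i then bs j else 0)"
      unfolding \<beta>_def count_sum using assms(1) by (intro sum.cong) auto
    then show ?thesis using that by simp
  qed
  have sub: "set_mset \<beta> \<subseteq> (\<lambda>i. k * i) ` {1..n}"
    unfolding \<beta>_def by (auto simp: set_mset_sum split: if_splits)
  have size: "size \<beta> = b" unfolding \<beta>_def using assms(2) by simp
  have "(\<Prod>x\<in>set_mset \<beta>. fact (count \<beta> x)) = (\<Prod>x\<in>(\<lambda>i. k * i) ` {1..n}. fact (count \<beta> x) :: nat)"
    using sub by (intro prod.mono_neutral_left) (auto simp: not_in_iff)
  also have "\<dots> = (\<Prod>i=1..n. fact (bs i))"
    using assms(1) cb by (subst prod.reindex) (auto simp: inj_on_def)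
  finally have "card (permutations_of_multiset \<beta>) * (\<Prod>i=1..n. fact (bs i)) = fact b"
    using card_permutations_of_multiset_aux[of \<beta>] size by simp
  moreover have "(\<Prod>i=1..n. fact (bs i) :: nat) \<noteq> 0" by simp
  ultimately show ?thesis unfolding multinomial_def \<beta>_def[symmetric] by (metis nonzero_mult_div_cancel_right)
qed

theorem theorem4p5:
  fixes n k r l b :: nat and bs s :: "nat \<Rightarrow> nat"
  assumes "0 < n" and "0 < l" and "0 < r" and "r < k"
    and "(\<Sum>i=1..n. bs i) = b"
    and "(\<Sum>i=1..n. i * bs i) \<le> n"
    and "(\<Sum>i=1..l+1. s i) = n"
    and "s 1 = n - b"
  shows "card {cs. nc_multichain k n r l cs \<and>
                   (\<forall>j\<in>{1..l+1}. rank_jump k n cs j = int (s j)) \<and>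
                   has_type k n (cs ! 0) b bs}
         = multinomial b bs n * (\<Prod>j=2..l+1. (k*n+r) choose (s j))"
proof -
  define N \<beta> t where "N = k * n + r" and "\<beta> = (\<Sum>i=1..n. replicate_mset (bs i) (k * i))"
    and "t = (\<lambda>i. s (i + 2))"
  have k: "0 < k" using assms(4) by simp
  have size: "size \<beta> = b" unfolding \<beta>_def using assms(5) by simp
  have "b \<le> (\<Sum>i=1..n. i * bs i)" unfolding assms(5)[symmetric] by (rule sum_mono) simp
  then have bn: "b \<le> n" using assms(6) by simp
  have inb: "\<exists>i\<in>{1..n}. m = k * i" if "m \<in># \<beta>" for m
    using that unfolding \<beta>_def by (auto simp: set_mset_sum split: if_splits)
  have b0: "0 \<notin># \<beta>" using inb[of 0] k by auto
  have dv: "k dvd m" if "m \<in># \<beta>" for m using inb[OF that] by auto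
  have sumb: "\<Sum>\<^sub># \<beta> = k * (\<Sum>i=1..n. i * bs i)"
  proof -
    have "\<Sum>\<^sub># (\<Sum>i\<in>A. replicate_mset (bs i) (k * i)) = (\<Sum>i\<in>A. k * (i * bs i))" if "finite A" for A
      using that by (induction A) (auto simp: mult_ac)
    then show ?thesis unfolding \<beta>_def by (simp add: sum_distrib_left)
  qed
  then have "\<Sum>\<^sub># \<beta> \<le> k * n" using assms(6) by simp
  then have lt: "\<Sum>\<^sub># \<beta> < N" unfolding N_def using assms(3) by simp
  \<comment> \<open>If the marked size occurred in \<beta>, then k would divide it and the sum of
    \<beta>, hence also N = kn + r.\<close>
  have mark: "N - \<Sum>\<^sub># \<beta> \<notin># \<beta>"
  proof
    assume "N - \<Sum>\<^sub># \<beta> \<in># \<beta>"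
    then have "k dvd N - \<Sum>\<^sub># \<beta>" by (rule dv)
    then have "k dvd N - \<Sum>\<^sub># \<beta> + \<Sum>\<^sub># \<beta>" using sumb by simp
    then show False using not_dvd_total[OF assms(3,4)] lt unfolding N_def by simp
  qed
  have shift: "Suc (Suc (a - 2)) = a" if "2 \<le> a" for a :: nat using that by simp
  \<comment> \<open>The hypothesis on \<open>s 1\<close> enters here: the remaining jumps add up to
    b, the number of unmarked blocks of the first partition.\<close>
  have sumt: "(\<Sum>i<l. t i) = b"
  proof -
    have "(\<Sum>i=1..l+1. s i) = s 1 + (\<Sum>i=2..l+1. s i)"
      by (subst sum.atLeast_Suc_atMost) (simp_all add: numeral_2_eq_2)
    also have "(\<Sum>i=2..l+1. s i) = (\<Sum>i<l. t i)" unfolding t_def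
      by (rule sum.reindex_bij_witness[of _ "\<lambda>i. i + 2" "\<lambda>i. i - 2"]) (auto simp: shift)
    finally show ?thesis using assms(7,8) bn by simp
  qed
  then have sumt': "(\<Sum>i=0..<l. s (i + 2)) = b" unfolding t_def by (simp only: atLeast0LessThan)
  have "{cs. nc_multichain k n r l cs \<and> (\<forall>j\<in>{1..l+1}. rank_jump k n cs j = int (s j)) \<and>
          has_type k n (cs ! 0) b bs} = marked_chains N l \<beta> t"
  proof (intro equalityI subsetI)
    fix cs assume "cs \<in> {cs. nc_multichain k n r l cs \<and> (\<forall>j\<in>{1..l+1}. rank_jump k n cs j = int (s j)) \<and>
          has_type k n (cs ! 0) b bs}"
    then have len: "length cs = l" and NC: "\<And>j. j < l \<Longrightarrow> NCk k n r (cs ! j)"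
      and ref: "\<And>j. Suc j < l \<Longrightarrow> refines (cs ! j) (cs ! Suc j)"
      and rj: "\<forall>j\<in>{1..l+1}. rank_jump k n cs j = int (s j)" and ty: "has_type k n (cs ! 0) b bs"
      unfolding nc_multichain_def by auto
    have bk: "\<forall>j<l. bkprime k (cs ! j) = (\<Sum>i=j..<l. t i)"
      using rj rank_jump_iff[where s = s and k = k, OF assms(2) len assms(8) bn sumt'] unfolding t_def by blast
    obtain y where y: "y \<in> {1..N}" "\<forall>m\<in>#outer_sizes y (cs ! 0). k dvd m"
      using NC[OF assms(2)] unfolding NCk_iff[OF assms(3,4)] N_def by blast
    have nc: "nc N (cs ! j)" if "j < l" for j
      using NC[OF that] unfolding NCk_iff[OF assms(3,4)] N_def by blast
    have "outer_sizes y (cs ! 0) = \<beta>"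
      using has_type_iff_outer_sizes[OF assms(3,4) nc[OF assms(2), unfolded N_def] y(1)[unfolded N_def] y(2) assms(5)] ty
      unfolding \<beta>_def by blast
    moreover have "card (cs ! j) = Suc (\<Sum>i=j..<l. t i)" if "j < l" for j
      using card_eq_bkprime[OF assms(3,4) NC[OF that]] bk that by simp
    ultimately have "cs \<in> typed_chains N l y \<beta> t"
      unfolding typed_chains_def nc_chains_def using len nc ref by blast
    then show "cs \<in> marked_chains N l \<beta> t" unfolding marked_chains_def using y(1) by blast
  next
    fix cs assume "cs \<in> marked_chains N l \<beta> t"
    then obtain y where y: "y \<in> {1..N}" and cs: "cs \<in> typed_chains N l y \<beta> t"
      unfolding marked_chains_def by blast
    have ch: "cs \<in> nc_chains N l" and len: "length cs = l" and nc: "\<And>j. j < l \<Longrightarrow> nc N (cs ! j)"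
      and ref: "\<And>j. Suc j < l \<Longrightarrow> refines (cs ! j) (cs ! Suc j)"
      and o: "outer_sizes y (cs ! 0) = \<beta>"
      and crd: "\<And>j. j < l \<Longrightarrow> card (cs ! j) = Suc (\<Sum>i=j..<l. t i)"
      using cs unfolding typed_chains_def nc_chains_def by auto
    have y2: "\<forall>m\<in>#outer_sizes y (cs ! 0). k dvd m" using o dv by simp
    have "NCk k n r (cs ! 0)"
      unfolding NCk_iff[OF assms(3,4)] using nc[OF assms(2)] y y2 unfolding N_def by blast
    then have NC: "NCk k n r (cs ! j)" if "j < l" for j
      using NCk_refines nc[OF that] nc_chains_refines[OF ch _ that, of 0] unfolding N_def by blast
    have ty: "has_type k n (cs ! 0) b bs"
      using has_type_iff_outer_sizes[OF assms(3,4) nc[OF assms(2), unfolded N_def] y[unfolded N_def] y2 assms(5)] o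
      unfolding \<beta>_def by blast
    have "\<forall>j<l. bkprime k (cs ! j) = (\<Sum>i=j..<l. t i)"
      using card_eq_bkprime[OF assms(3,4) NC] crd by simp
    then have rj: "\<forall>j\<in>{1..l+1}. rank_jump k n cs j = int (s j)"
      using rank_jump_iff[where s = s and k = k, OF assms(2) len assms(8) bn sumt'] unfolding t_def by blast
    have "nc_multichain k n r l cs"
      unfolding nc_multichain_def using len NC ref by (auto simp: in_set_conv_nth)
    then show "cs \<in> {cs. nc_multichain k n r l cs \<and> (\<forall>j\<in>{1..l+1}. rank_jump k n cs j = int (s j)) \<and>
          has_type k n (cs ! 0) b bs}" using ty rj by simp
  qed
  then have "card {cs. nc_multichain k n r l cs \<and> (\<forall>j\<in>{1..l+1}. rank_jump k n cs j = int (s j)) \<and>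
          has_type k n (cs ! 0) b bs} = card (permutations_of_multiset \<beta>) * (\<Prod>i<l. N choose t i)"
    using card_marked_chains[OF assms(2) b0 lt _ mark, of t] sumt size by simp
  also have "card (permutations_of_multiset \<beta>) = multinomial b bs n"
    unfolding \<beta>_def by (rule card_permutations_block_sizes[OF k assms(5)])
  also have "(\<Prod>i<l. N choose t i) = (\<Prod>j=2..l+1. (k*n+r) choose (s j))"
    unfolding t_def N_def by (rule prod.reindex_bij_witness[of _ "\<lambda>i. i - 2" "\<lambda>i. i + 2"]) (auto simp: shift)
  finally show ?thesis .
qed

end
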